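(* Let $X$ be a Hilbert space, $(\mathcal P,d)$ a metric space, $C\subset X$ a closed convex set, $f\colon X\times\mathcal P\to X$ a mapping, and let $\bar x\in\hat S(\bar v,\bar p)$, where $$\hat S(v,p)=\{x\in X\mid v\in f(x,p)+N_C(x)\}.$$ Put $\hat v:=\bar v-f(\bar x,\bar p)$ and assume that (A1) and (A4) (see context) are satisfied. Consider the following statements: (i) $\bar x$ is a (Lipschitzian) fully stable solution to $v\in f(x,p)+N_C(x)$ corresponding to $(\bar v,\bar p)$. (ii) $\langle\nabla_xf(\bar x,\bar p)w,w\rangle>0$ for all $w\in\mathcal H^{\rm w}(\bar x,\hat v)$, $w\ne0$, where $\mathcal H^{\rm w}(\bar x,\hat v)$ is the set of all $z\in X$ for which there are $(x_k,v_k)\in\operatorname{gph}N_C$ with $(x_k,v_k)\to(\bar x,\hat v)$ (in norm) and $z_k\in\mathcal K_C(x_k,v_k)$ with $z_k\to z$ weakly. (iii) $\langle\nabla_xf(\bar x,\bar p)w,w\rangle>0$ for all $w\in\mathcal H^{\rm s}(\bar x,\hat v)$, $w\ne0$, where $\mathcal H^{\rm s}(\bar x,\hat v)$ is the set of all $z\in X$ for which there are $(x_k,v_k)\in\operatorname{gph}N_C$ with $(x_k,v_k)\to(\bar x,\hat v)$ (in norm) and $z_k\in\mathcal K_C(x_k,v_k)$ with $\|z_k-z\|\to0$. Then the following assertions are satisfied: (A) If $Q(w):=\langle\nabla_xf(\bar x,\bar p)w,w\rangle$ is a Legendre form, then (ii)$\Rightarrow$(i). (B) If $C$ is polyhedric,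 then (i)$\Rightarrow$(iii).
   Context: $X$ is a real Hilbert space identified with its dual; $N_C(x)$ is the normal cone of convex analysis ($=\emptyset$ for $x\notin C$). For $x\in C$ the radial cone is $\mathcal R_C(x)=\bigcup_{t>0}\frac{C-x}{t}$, the tangent cone is $T_C(x)=\operatorname{cl}\mathcal R_C(x)$, and for $v\in N_C(x)$ the critical cone is $\mathcal K_C(x,v)=T_C(x)\cap\{v\}^\perp$. $C$ is polyhedric at $x\in C$ for $v\in N_C(x)$ if $\mathcal K_C(x,v)=\operatorname{cl}\{\mathcal R_C(x)\cap\{v\}^\perp\}$; $C$ is polyhedric if this holds for each $x\in C$ and each $v\in N_C(x)$. A function $Q\colon X\to\mathbb R$ is a Legendre form if it is weakly lower semicontinuous, is of the form $Q(x)=\langle Ax,x\rangle$ with some linear operator $A\colon X\to X$, and satisfies: $x_k\to x$ weakly and $Q(x_k)\to Q(x)$ imply $x_k\to x$ in norm. Assumptions. (A1) There are $L>0$ and a neighborhood $U\times P$ of $(\bar x,\bar p)$ on which $\|f(x_1,p_1)-f(x_2,p_2)\|\le L[\|x_1-x_2\|+d(p_1,p_2)]$. (A4) $f$ is Fréchet differentiable with respect to $x$ around $(\bar x,\bar p)$ uniformly in $p$ (i.e. there is a neighborhood $U\times P$ of $(\bar x,\bar p)$ such that for each $x\in U$ the Fréchet derivative of $f(\cdot,p)$ at $x$ exists for all $p\in P$ with remainder $o(\|h\|)$ uniform in $p$), and $\nabla_xf$ is continuous at $(\bar x,\bar p)$. Full stability. $\bar x$ is a (Lipschitzian) fully stable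 solution corresponding to $(\bar v,\bar p)$ if there are a neighborhood $V\times P\times U$ of $(\bar v,\bar p,\bar x)$ and a single-valued mapping $\vartheta\colon V\times P\to U$, defined on all of $V\times P$, with $\operatorname{gph}\vartheta=\operatorname{gph}\hat S\cap(V\times P\times U)$, together with $\kappa,\ell>0$ such that for all $(v_1,p_1),(v_2,p_2)\in V\times P$ $$\|(v_1-v_2)-2\kappa[\vartheta(v_1,p_1)-\vartheta(v_2,p_2)]\|\le\|v_1-v_2\|+\ell d(p_1,p_2).$$ *)

theory Defs
  imports "HOL-Analysis.Analysis"
begin

subsection \<open>Normal, radial, tangent and critical cones; polyhedricity\<close>

definition normal_cone :: "'a::real_inner set \<Rightarrow> 'a \<Rightarrow> 'a set" where
  "normal_cone C x = (if x \<in> C then {v. \<forall>y\<in>C. v \<bullet> (y - x) \<le> 0} else {})"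

definition radial_cone :: "'a::real_inner set \<Rightarrow> 'a \<Rightarrow> 'a set" where
  "radial_cone C x = (\<Union>t\<in>{0<..}. (\<lambda>y. (y - x) /\<^sub>R t) ` C)"

definition tangent_cone :: "'a::real_inner set \<Rightarrow> 'a \<Rightarrow> 'a set" where
  "tangent_cone C x = closure (radial_cone C x)"

definition critical_cone :: "'a::real_inner set \<Rightarrow> 'a \<Rightarrow> 'a \<Rightarrow> 'a set" where
  "critical_cone C x v = tangent_cone C x \<inter> {v}\<^sup>\<bottom>"

definition polyhedric_at :: "'a::real_inner set \<Rightarrow> 'a \<Rightarrow> 'a \<Rightarrow> bool" where
  "polyhedric_at C x v \<longleftrightarrow>
     critical_cone C x v = closure (radial_cone C x \<inter> {v}\<^sup>\<bottom>)"

definition polyhedric :: "'a::real_inner set \<Rightarrow> bool" where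
  "polyhedric C \<longleftrightarrow> (\<forall>x\<in>C. \<forall>v\<in>normal_cone C x. polyhedric_at C x v)"

subsection \<open>Weak topology and Legendre forms\<close>

text \<open>The coarsest topology making every functional \<open>x \<mapsto> x \<bullet> y\<close> continuous: it is pulled back
  from the product topology on functions \<open>'a \<Rightarrow> real\<close>. On a Hilbert space identified with its dual
  this is the weak topology.\<close>

definition weak_topology :: "'a::real_inner topology" where
  "weak_topology = pullback_topology UNIV (\<lambda>x y. x \<bullet> y) euclidean"

abbreviation weakly_tendsto :: "(nat \<Rightarrow> 'a::real_inner) \<Rightarrow> 'a \<Rightarrow> bool" where
  "weakly_tendsto z l \<equiv> limitin weak_topology z l sequentially"

lemma weakly_tendsto_iff: "weakly_tendsto z l \<longleftrightarrow> (\<forall>y. (\<lambda>k. z k \<bullet> y) \<longlonglongrightarrow> l \<bullet> y)"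
proof -
  have op: "openin weak_topology U \<longleftrightarrow> (\<exists>W::('a \<Rightarrow> real) set. open W \<and> U = (\<bullet>) -` W)" for U :: "'a set"
    by (simp add: weak_topology_def openin_pullback_topology)
  have top: "topspace weak_topology = (UNIV :: 'a set)"
    by (simp add: weak_topology_def topspace_pullback_topology)
  have "weakly_tendsto z l \<longleftrightarrow>
      (\<forall>W::('a \<Rightarrow> real) set. open W \<and> l \<in> (\<bullet>) -` W \<longrightarrow> (\<forall>\<^sub>F k in sequentially. z k \<in> (\<bullet>) -` W))"
    unfolding limitin_def top op by blast
  also have "\<dots> \<longleftrightarrow> ((\<lambda>k. (\<bullet>) (z k)) \<longlonglongrightarrow> (\<bullet>) l)"
    unfolding tendsto_def vimage_eq by blast
  also have "\<dots> \<longleftrightarrow> limitin (product_topology (\<lambda>i. euclidean) UNIV) (\<lambda>k. (\<bullet>) (z k)) ((\<bullet>) l) sequentially"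
    by (simp add: euclidean_product_topology)
  also have "\<dots> \<longleftrightarrow> (\<forall>y. (\<lambda>k. z k \<bullet> y) \<longlonglongrightarrow> l \<bullet> y)"
    by (simp add: limitin_componentwise)
  finally show ?thesis .
qed

definition weakly_lsc :: "('a::real_inner \<Rightarrow> real) \<Rightarrow> bool" where
  "weakly_lsc Q \<longleftrightarrow> (\<forall>a. closedin weak_topology {x. Q x \<le> a})"

definition Legendre_form :: "('a::real_inner \<Rightarrow> real) \<Rightarrow> bool" where
  "Legendre_form Q \<longleftrightarrow>
     weakly_lsc Q \<and>
     (\<exists>A. linear A \<and> (\<forall>x. Q x = A x \<bullet> x)) \<and>
     (\<forall>u x. weakly_tendsto u x \<and> (\<lambda>k. Q (u k)) \<longlonglongrightarrow> Q x \<longrightarrow> u \<longlonglongrightarrow> x)"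

subsection \<open>Limits of critical cones\<close>

definition H_weak :: "'a::real_inner set \<Rightarrow> 'a \<Rightarrow> 'a \<Rightarrow> 'a set" where
  "H_weak C x v = {z. \<exists>xk vk zk. (\<forall>k. vk k \<in> normal_cone C (xk k)) \<and>
     xk \<longlonglongrightarrow> x \<and> vk \<longlonglongrightarrow> v \<and>
     (\<forall>k. zk k \<in> critical_cone C (xk k) (vk k)) \<and> weakly_tendsto zk z}"

definition H_strong :: "'a::real_inner set \<Rightarrow> 'a \<Rightarrow> 'a \<Rightarrow> 'a set" where
  "H_strong C x v = {z. \<exists>xk vk zk. (\<forall>k. vk k \<in> normal_cone C (xk k)) \<and>
     xk \<longlonglongrightarrow> x \<and> vk \<longlonglongrightarrow> v \<and>
     (\<forall>k. zk k \<in> critical_cone C (xk k) (vk k)) \<and> (\<lambda>k. norm (zk k - z)) \<longlonglongrightarrow> 0}"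

subsection \<open>The parametric variational inequality\<close>

definition solution_map ::
    "('a::real_inner \<Rightarrow> 'p \<Rightarrow> 'a) \<Rightarrow> 'a set \<Rightarrow> 'a \<Rightarrow> 'p \<Rightarrow> 'a set" where
  "solution_map f C v p = {x. v \<in> (\<lambda>n. f x p + n) ` normal_cone C x}"

text \<open>Only meaningful where \<open>\<lambda>y. f y p\<close> is differentiable at \<open>x\<close>. Taking values in
  \<open>'a \<Rightarrow>\<^sub>L 'a\<close> makes continuity of \<open>nabla_x f\<close> refer to the operator norm.\<close>

definition nabla_x ::
    "('a::real_normed_vector \<Rightarrow> 'p \<Rightarrow> 'a) \<Rightarrow> 'a \<Rightarrow> 'p \<Rightarrow> 'a \<Rightarrow>\<^sub>L 'a" where
  "nabla_x f x p = Blinfun (frechet_derivative (\<lambda>y. f y p) (at x))"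

definition assumption_A1 ::
    "('a::real_normed_vector \<Rightarrow> 'p::metric_space \<Rightarrow> 'a) \<Rightarrow> 'a \<Rightarrow> 'p \<Rightarrow> bool" where
  "assumption_A1 f xbar pbar \<longleftrightarrow>
     (\<exists>L>0. \<exists>U P. open U \<and> xbar \<in> U \<and> open P \<and> pbar \<in> P \<and>
       (\<forall>x1\<in>U. \<forall>x2\<in>U. \<forall>p1\<in>P. \<forall>p2\<in>P.
          norm (f x1 p1 - f x2 p2) \<le> L * (norm (x1 - x2) + dist p1 p2)))"

text \<open>The remainder is \<open>o(\<parallel>h\<parallel>)\<close> uniformly in \<open>p\<close>, for each fixed \<open>x\<close>.\<close>

definition assumption_A4 ::
    "('a::real_normed_vector \<Rightarrow> 'p::metric_space \<Rightarrow> 'a) \<Rightarrow> 'a \<Rightarrow> 'p \<Rightarrow> bool" where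
  "assumption_A4 f xbar pbar \<longleftrightarrow>
     (\<exists>U P. open U \<and> xbar \<in> U \<and> open P \<and> pbar \<in> P \<and>
       (\<forall>x\<in>U. (\<forall>p\<in>P. (\<lambda>y. f y p) differentiable (at x)) \<and>
          (\<forall>\<epsilon>>0. \<exists>\<delta>>0. \<forall>p\<in>P. \<forall>h. norm h < \<delta> \<longrightarrow>
             norm (f (x + h) p - f x p - blinfun_apply (nabla_x f x p) h) \<le> \<epsilon> * norm h))) \<and>
     isCont (\<lambda>(x, p). nabla_x f x p) (xbar, pbar)"

definition fully_stable ::
    "('a::real_normed_vector \<Rightarrow> 'p::metric_space \<Rightarrow> 'a set) \<Rightarrow> 'a \<Rightarrow> 'p \<Rightarrow> 'a \<Rightarrow> bool" where
  "fully_stable S vbar pbar xbar \<longleftrightarrow>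
     (\<exists>V P U \<theta>. open V \<and> vbar \<in> V \<and> open P \<and> pbar \<in> P \<and> open U \<and> xbar \<in> U \<and>
       {(v, p, x). v \<in> V \<and> p \<in> P \<and> x = \<theta> v p} = {(v, p, x). x \<in> S v p} \<inter> (V \<times> P \<times> U) \<and>
       (\<exists>\<kappa>>0. \<exists>l>0. \<forall>v1\<in>V. \<forall>v2\<in>V. \<forall>p1\<in>P. \<forall>p2\<in>P.
          norm ((v1 - v2) - (2 * \<kappa>) *\<^sub>R (\<theta> v1 p1 - \<theta> v2 p2)) \<le> norm (v1 - v2) + l * dist p1 p2))"

end

theory Submission
  imports Defs "HOL-Library.Diagonal_Subsequence"
begin

text \<open>Full stability amounts to strong monotonicity of the inclusion, which has to be tested along the graph of
  the normal cone, and critical directions are those in which the first component of a point of that graph can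
  move. One half of this is that a Lipschitz curve \<open>t \<mapsto> (x t, n t)\<close> in the graph has only critical velocities: the
  quotient \<open>q = (x s - x t) / (s - t)\<close> lies in the radial cone at \<open>x t\<close>, and since \<open>n t \<bullet> q \<le> 0\<close> and
  \<open>n s \<bullet> q \<ge> 0\<close> for \<open>s > t\<close>, every weak limit of such quotients is also orthogonal to \<open>n t\<close>
  (\<open>difference_quotient_weak_limit\<close>).

  \<^bold>\<open>From critical cones to full stability.\<close> Write \<open>A\<close> for the partial derivative at the reference point.
  A weak compactness argument, in which the Legendre property excludes a weak limit \<open>0\<close> of unit
  vectors, turns positivity on the weak limits of critical cones into a bound
  \<open>\<kappa> * (norm w)\<^sup>2 \<le> A w \<bullet> w\<close> on all critical cones at points of the graph close to
  \<open>(xbar, vhat)\<close> (\<open>uniformly_positive_on_critical_cones\<close>). Suppose that \<open>y \<in> A x + l *\<^sub>R x + normal_cone C x\<close>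
  is locally solvable with a Lipschitz solution. If \<open>y\<close> runs through a segment with direction
  \<open>\<Delta>\<close>, the velocities \<open>\<xi>\<close> of the solution are critical, and monotonicity of the normal cone gives
  \<open>\<kappa> * (norm \<xi>)\<^sup>2 \<le> \<Delta> \<bullet> \<xi>\<close>. Integrated over the segment, this says that the inclusion is
  strongly monotone with the modulus \<open>\<kappa>\<close>, whatever modulus one started from
  (\<open>strong_solvability_improve\<close>). Since \<open>\<kappa>\<close> does not deteriorate, one can start from a large \<open>l\<close>,
  where solvability is a perturbation of the metric projection onto \<open>C\<close>, and lower \<open>l\<close> to \<open>0\<close> in finitely many
  contraction steps (\<open>strong_solvability_of_positive\<close>). A last contraction step replaces \<open>A\<close> by
  \<open>\<lambda>x. f x p\<close>, from which it differs by a map with small Lipschitz constant, uniformly in \<open>p\<close>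
  (\<open>fully_stable_of_strong_solvability\<close>).

  \<^bold>\<open>From full stability to critical cones.\<close> The other half holds under polyhedricity: a critical direction is a limit of directions \<open>w\<close>
  in the radial cone with \<open>n \<bullet> w = 0\<close>. For small \<open>t > 0\<close> the point \<open>x + t *\<^sub>R w\<close> is in \<open>C\<close> and has the same
  normal \<open>n\<close>. The full stability estimate for this pair of solutions only sees the
  increment of \<open>f\<close>, and letting \<open>t\<close> tend to \<open>0\<close> gives \<open>\<kappa> * (norm w)\<^sup>2 \<le> f' w \<bullet> w\<close> with \<open>f'\<close> the derivative at \<open>x\<close>
  (\<open>derivative_bound_of_strong_monotonicity\<close>); continuity of the derivative passes this to the limit.\<close>

section \<open>Projection and weak compactness in Hilbert space\<close>

lemma infdist_almost_attained:
  assumes "infdist a S < e" "S \<noteq> {}"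
  shows "\<exists>x\<in>S. dist a x < e"
proof (rule ccontr)
  assume "\<not> ?thesis"
  then have "e \<le> (INF x\<in>S. dist a x)" by (intro cINF_greatest assms) (auto simp: not_less)
  then show False using assms by (simp add: infdist_notempty)
qed

text \<open>Almost shortest elements of the sets form a Cauchy sequence by the parallelogram law, because
  their norms approach the limit of the increasing distances to \<open>0\<close> and midpoints cannot be shorter than
  these distances. The result stands in for weak compactness: it gives the metric projection
  and, later, weak cluster points, without a representation theorem for functionals.\<close>

lemma nested_closed_convex_nonempty:
  fixes K :: "nat \<Rightarrow> 'a::{real_inner, complete_space} set"
  assumes closed: "\<And>n. closed (K n)" and convex: "\<And>n. convex (K n)"
    and ne: "\<And>n. K n \<noteq> {}" and dec: "decseq K" and bdd: "bounded (K 0)"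
  shows "(\<Inter>n. K n) \<noteq> {}"
proof -
  define d where "d n = infdist 0 (K n)" for n
  obtain B where B: "\<And>x. x \<in> K 0 \<Longrightarrow> norm x \<le> B"
    using bdd by (auto simp: bounded_iff)
  have sub: "K m \<subseteq> K n" if "n \<le> m" for n m
    using dec that by (auto simp: decseq_def)
  have "incseq d"
    unfolding d_def by (intro monoI infdist_mono sub ne)
  have d_le: "d n \<le> norm x" if "x \<in> K n" for n x
    unfolding d_def using infdist_le[OF that, of 0] by simp
  have "d n \<le> B" for n
    using ne[of n] d_le[of _ n] B sub[of 0 n] by (meson all_not_in_conv le0 order_trans subsetD)
  then obtain D where D: "d \<longlonglongrightarrow> D" "\<And>n. d n \<le> D"
    using incseq_convergent[OF \<open>incseq d\<close>] by metis
  have "\<exists>x\<in>K n. norm x < d n + 1 / Suc n" for n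
  proof -
    have "infdist 0 (K n) < d n + 1 / Suc n" by (simp add: d_def)
    then show ?thesis using infdist_almost_attained[OF _ ne[of n]] by fastforce
  qed
  then obtain x where xK: "\<And>n. x n \<in> K n" and x: "\<And>n. norm (x n) < d n + 1 / Suc n"
    by metis
  define e where "e n = 4 * ((D + 1 / Suc n)\<^sup>2 - (d n)\<^sup>2)" for n
  have d0: "0 \<le> d n" for n by (simp add: d_def infdist_nonneg)
  have bound: "(norm (x n - x m))\<^sup>2 \<le> e N" if "N \<le> n" "N \<le> m" for n m N
  proof -
    have le: "(norm (x k))\<^sup>2 \<le> (D + 1 / Suc N)\<^sup>2" if "N \<le> k" for k
    proof -
      have "1 / real (Suc k) \<le> 1 / Suc N" using that by (simp add: frac_le)
      then have "norm (x k) \<le> D + 1 / Suc N" using x[of k] D(2)[of k] by linarith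
      then show ?thesis by (simp add: power_mono)
    qed
    have "(1/2) *\<^sub>R x n + (1/2) *\<^sub>R x m \<in> K N"
      using xK[of n] xK[of m] sub[OF that(1)] sub[OF that(2)]
      by (intro convexD[OF convex[of N]]) auto
    then have "d N \<le> norm ((1/2) *\<^sub>R x n + (1/2) *\<^sub>R x m)" by (rule d_le)
    then have "(d N)\<^sup>2 \<le> (norm ((1/2) *\<^sub>R x n + (1/2) *\<^sub>R x m))\<^sup>2"
      using d0 by (simp add: power_mono)
    moreover have "(norm (x n - x m))\<^sup>2 = 2 * (norm (x n))\<^sup>2 + 2 * (norm (x m))\<^sup>2
        - 4 * (norm ((1/2) *\<^sub>R x n + (1/2) *\<^sub>R x m))\<^sup>2"
      by (simp add: power2_norm_eq_inner algebra_simps inner_commute)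
    ultimately show ?thesis using le[OF that(1)] le[OF that(2)] by (simp add: e_def)
  qed
  have "(\<lambda>n. 4 * ((D + inverse (real (Suc n)))\<^sup>2 - (d n)\<^sup>2)) \<longlonglongrightarrow> 4 * ((D + 0)\<^sup>2 - D\<^sup>2)"
    by (intro tendsto_intros D LIMSEQ_inverse_real_of_nat)
  then have e: "e \<longlonglongrightarrow> 0" by (simp add: e_def[abs_def] inverse_eq_divide)
  have "Cauchy x"
  proof (rule CauchyI)
    fix \<epsilon> :: real assume "0 < \<epsilon>"
    then have "\<forall>\<^sub>F n in sequentially. e n < \<epsilon>\<^sup>2"
      using order_tendstoD(2)[OF e] by simp
    then obtain N where "e N < \<epsilon>\<^sup>2" by (auto simp: eventually_sequentially)
    then have "norm (x m - x n) < \<epsilon>" if "N \<le> m" "N \<le> n" for m n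
      using bound[OF that] \<open>0 < \<epsilon>\<close> by (meson le_less_trans less_imp_le power2_less_imp_less)
    then show "\<exists>M. \<forall>m\<ge>M. \<forall>n\<ge>M. norm (x m - x n) < \<epsilon>" by blast
  qed
  then obtain l where l: "x \<longlonglongrightarrow> l"
    using Cauchy_convergent_iff convergent_def by blast
  have "l \<in> K n" for n
  proof (rule closed_sequentially[OF closed[of n], of "\<lambda>k. x (k + n)"])
    show "\<And>k. x (k + n) \<in> K n" using xK sub by (meson le_add2 subsetD)
    show "(\<lambda>k. x (k + n)) \<longlonglongrightarrow> l" using l by (rule LIMSEQ_ignore_initial_segment)
  qed
  then show ?thesis by blast
qed

text \<open>A nearest point is a common point of \<open>C\<close> and the balls around \<open>a\<close> whose radii decrease to the distance.\<close>

lemma hilbert_projection: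
  fixes C :: "'a::{real_inner, complete_space} set"
  assumes "closed C" "convex C" "C \<noteq> {}"
  obtains x where "x \<in> C" "\<And>z. z \<in> C \<Longrightarrow> (a - x) \<bullet> (z - x) \<le> 0"
proof -
  define r where "r n = infdist a C + 1 / Suc n" for n
  define K where "K n = C \<inter> cball a (r n)" for n
  have "(\<Inter>n. K n) \<noteq> {}"
  proof (rule nested_closed_convex_nonempty)
    show "closed (K n)" "convex (K n)" for n
      using assms by (auto simp: K_def convex_Int)
    have "infdist a C < r n" for n by (simp add: r_def)
    then show "K n \<noteq> {}" for n
      using infdist_almost_attained[OF _ assms(3), of a "r n"] by (fastforce simp: K_def)
    have "r n \<le> r m" if "m \<le> n" for m n
      using that by (simp add: r_def frac_le)
    then show "decseq K" unfolding decseq_def K_def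
      by (meson Int_mono order_refl subset_cball)
    show "bounded (K 0)" by (simp add: K_def bounded_Int)
  qed
  then obtain x where x: "x \<in> C" "\<And>n. dist a x \<le> r n"
    unfolding K_def by fastforce
  have "(\<lambda>n. infdist a C + inverse (real (Suc n))) \<longlonglongrightarrow> infdist a C + 0"
    by (intro tendsto_intros LIMSEQ_inverse_real_of_nat)
  then have "r \<longlonglongrightarrow> infdist a C" by (simp add: r_def[abs_def] inverse_eq_divide)
  then have "dist a x \<le> infdist a C"
    using x(2) by (intro LIMSEQ_le_const) auto
  then have "\<forall>z\<in>C. dist a x \<le> dist a z"
    using infdist_le order_trans by blast
  then show thesis
    using any_closest_point_dot[OF assms(2,1) x(1)] x(1) that by blast
qed

text \<open>The half-space through the projection of \<open>l\<close> onto \<open>K\<close>, with normal pointing towards \<open>l\<close>, separates \<open>l\<close> from the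
  sequence unless \<open>l\<close> is its own projection.\<close>

lemma weak_limit_in_closed_convex:
  fixes K :: "'a::{real_inner, complete_space} set"
  assumes "closed K" "convex K" and "\<And>n. u n \<in> K" and w: "weakly_tendsto u l"
  shows "l \<in> K"
proof -
  have "K \<noteq> {}" using assms(3) by blast
  then obtain x where x: "x \<in> K" "\<And>z. z \<in> K \<Longrightarrow> (l - x) \<bullet> (z - x) \<le> 0"
    using hilbert_projection[OF assms(1,2)] by metis
  have "(\<lambda>n. u n \<bullet> (l - x)) \<longlonglongrightarrow> l \<bullet> (l - x)"
    using w by (simp add: weakly_tendsto_iff)
  moreover have "u n \<bullet> (l - x) \<le> x \<bullet> (l - x)" for n
    using x(2)[OF assms(3)[of n]] by (simp add: inner_diff_right inner_diff_left inner_commute)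
  ultimately have "l \<bullet> (l - x) \<le> x \<bullet> (l - x)" by (intro LIMSEQ_le_const2) auto
  then have "(l - x) \<bullet> (l - x) \<le> 0" by (simp add: inner_diff_left)
  then have "l = x" by (metis inner_gt_zero_iff not_less right_minus_eq)
  then show ?thesis using x(1) by simp
qed

text \<open>A diagonal subsequence makes \<open>x (r k) \<bullet> x n\<close> converge for every \<open>n\<close>. The vectors \<open>y\<close> for which
  \<open>x (r k) \<bullet> y\<close> converges form a closed subspace containing all \<open>x n\<close>, and the component of \<open>y\<close>
  orthogonal to that subspace contributes nothing.\<close>

lemma bounded_inner_convergent_subseq:
  fixes x :: "nat \<Rightarrow> 'a::{real_inner, complete_space}"
  assumes "\<And>n. norm (x n) \<le> B"
  obtains r where "strict_mono r" "\<And>y. convergent (\<lambda>k. x (r k) \<bullet> y)"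
proof -
  interpret subseqs "\<lambda>n s. convergent (\<lambda>k. x (s k) \<bullet> x n)"
  proof
    fix n and s :: "nat \<Rightarrow> nat" assume "strict_mono s"
    have "x (s k) \<bullet> x n \<in> cball 0 (B * B)" for k
      using Cauchy_Schwarz_ineq2[of "x (s k)" "x n"]
        mult_mono[OF assms[of "s k"] assms[of n]] norm_ge_zero[of "x n"]
        order_trans[OF norm_ge_zero assms[of n]]
      by (simp add: dist_norm)
    then have "\<forall>k. (\<lambda>k. x (s k) \<bullet> x n) k \<in> cball 0 (B * B)" by blast
    then have "\<exists>l\<in>cball 0 (B * B). \<exists>r. strict_mono (r::nat\<Rightarrow>nat) \<and> ((\<lambda>k. x (s k) \<bullet> x n) \<circ> r) \<longlonglongrightarrow> l"
      using compact_cball[of "0::real" "B*B"] unfolding compact_def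
      by (elim allE[of _ "\<lambda>k. x (s k) \<bullet> x n"] impE)
    then show "\<exists>r'. strict_mono r' \<and> convergent (\<lambda>k. x ((s \<circ> r') k) \<bullet> x n)"
      unfolding convergent_def by (auto simp: o_def)
  qed
  define r where "r = diagseq"
  have r: "strict_mono r" unfolding r_def by (rule subseq_diagseq)
  define G where "G = {y. convergent (\<lambda>k. x (r k) \<bullet> y)}"
  have xG: "x n \<in> G" for n
  proof -
    have "convergent (\<lambda>k. x ((diagseq \<circ> ((+) (Suc n))) k) \<bullet> x n)"
    proof (rule diagseq_holds)
      fix r s :: "nat \<Rightarrow> nat" and n assume "strict_mono r" "convergent (\<lambda>k. x (s k) \<bullet> x n)"
      then show "convergent (\<lambda>k. x ((s \<circ> r) k) \<bullet> x n)"
        using convergent_subseq_convergent[of "\<lambda>k. x (s k) \<bullet> x n" r] by (simp add: o_def)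
    qed
    then have "convergent (\<lambda>k. x (diagseq (k + Suc n)) \<bullet> x n)" by (simp add: o_def add.commute)
    then show ?thesis
      using convergent_ignore_initial_segment[of "\<lambda>k. x (diagseq k) \<bullet> x n" "Suc n"]
      unfolding G_def r_def by simp
  qed
  have G: "subspace G"
    unfolding subspace_def G_def
  proof (intro conjI ballI allI; clarsimp simp: inner_add_right convergent_const)
    show "convergent (\<lambda>k. x (r k) \<bullet> y + x (r k) \<bullet> z)"
      if "convergent (\<lambda>k. x (r k) \<bullet> y)" "convergent (\<lambda>k. x (r k) \<bullet> z)" for y z
      using that by (rule convergent_add)
    show "convergent (\<lambda>k. c * (x (r k) \<bullet> y))" if "convergent (\<lambda>k. x (r k) \<bullet> y)" for c y
      using convergent_mult[OF convergent_const that] .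
  qed
  have B0: "0 \<le> B" using assms[of 0] norm_ge_zero order_trans by blast
  have "closed G"
    unfolding closed_sequential_limits
  proof (intro allI impI, elim conjE)
    fix g l assume g: "\<forall>n. g n \<in> G" "g \<longlonglongrightarrow> l"
    have "Cauchy (\<lambda>k. x (r k) \<bullet> l)"
    proof (rule CauchyI)
      fix e :: real assume "0 < e"
      then have "0 < e / (3 * (B + 1))" using B0 by simp
      then obtain n where n: "norm (g n - l) < e / (3 * (B + 1))"
        using g(2) by (auto simp: LIMSEQ_iff)
      have "Cauchy (\<lambda>k. x (r k) \<bullet> g n)"
        using g(1) by (auto simp: G_def Cauchy_convergent_iff)
      then obtain M where M: "\<And>i j. i \<ge> M \<Longrightarrow> j \<ge> M \<Longrightarrow> \<bar>x (r i) \<bullet> g n - x (r j) \<bullet> g n\<bar> < e / 3"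
        using CauchyD[of "\<lambda>k. x (r k) \<bullet> g n" "e / 3"] \<open>0 < e\<close> by auto
      have small: "\<bar>x (r i) \<bullet> (g n - l)\<bar> \<le> e / 3" for i
      proof -
        have "\<bar>x (r i) \<bullet> (g n - l)\<bar> \<le> norm (x (r i)) * norm (g n - l)" by (rule Cauchy_Schwarz_ineq2)
        also have "\<dots> \<le> (B + 1) * (e / (3 * (B + 1)))"
          using assms[of "r i"] n B0 by (intro mult_mono) auto
        also have "\<dots> = e / 3" using B0 by (simp add: field_simps)
        finally show ?thesis .
      qed
      have "norm (x (r i) \<bullet> l - x (r j) \<bullet> l) < e" if "i \<ge> M" "j \<ge> M" for i j
        using small[of i] small[of j] M[OF that] unfolding inner_diff_right real_norm_def by linarith
      then show "\<exists>M. \<forall>m\<ge>M. \<forall>n\<ge>M. norm (x (r m) \<bullet> l - x (r n) \<bullet> l) < e" by blast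
    qed
    then show "l \<in> G" by (simp add: G_def Cauchy_convergent_iff)
  qed
  have "convergent (\<lambda>k. x (r k) \<bullet> y)" for y
  proof -
    obtain m where m: "m \<in> G" "\<And>z. z \<in> G \<Longrightarrow> (y - m) \<bullet> (z - m) \<le> 0"
      using hilbert_projection[OF \<open>closed G\<close> subspace_imp_convex[OF G]] xG by (metis empty_iff)
    have "x (r k) \<bullet> y = x (r k) \<bullet> m" for k
    proof -
      have "m + x (r k) \<in> G" "m - x (r k) \<in> G"
        using G m(1) xG by (auto intro: subspace_add subspace_diff)
      from m(2)[OF this(1)] m(2)[OF this(2)] show ?thesis
        by (simp add: inner_diff_left inner_commute)
    qed
    then show ?thesis using m(1) by (simp add: G_def)
  qed
  with r show thesis by (rule that)
qed

text \<open>The weak limit is found as a common point of the closed convex hulls of the tails: each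
  functional is nearly constant on such a hull, with a value near its limit along the sequence.\<close>

lemma bounded_weakly_convergent_subseq:
  fixes x :: "nat \<Rightarrow> 'a::{real_inner, complete_space}"
  assumes "\<And>n. norm (x n) \<le> B"
  obtains r l where "strict_mono r" "weakly_tendsto (x \<circ> r) l"
proof -
  obtain r where r: "strict_mono r" "\<And>y. convergent (\<lambda>k. x (r k) \<bullet> y)"
    using bounded_inner_convergent_subseq[where x = x, OF assms] by metis
  define K where "K n = closure (convex hull (\<lambda>k. x (r k)) ` {n..})" for n
  have "(\<Inter>n. K n) \<noteq> {}"
  proof (rule nested_closed_convex_nonempty)
    show "decseq K" unfolding decseq_def K_def
      by (intro allI impI closure_mono hull_mono image_mono) auto
    have "bounded ((\<lambda>k. x (r k)) ` {0..})" using assms by (auto simp: bounded_iff)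
    then show "bounded (K 0)" unfolding K_def
      by (intro bounded_closure bounded_convex_hull)
  qed (auto simp: K_def convex_closure)
  then obtain l where l: "\<And>n. l \<in> K n" by blast
  have "(\<lambda>k. x (r k) \<bullet> y) \<longlonglongrightarrow> l \<bullet> y" for y
  proof -
    obtain a where a: "(\<lambda>k. x (r k) \<bullet> y) \<longlonglongrightarrow> a"
      using r(2)[of y] by (auto simp: convergent_def)
    have "\<bar>l \<bullet> y - a\<bar> \<le> e" if "0 < e" for e
    proof -
      obtain N where N: "\<And>k. k \<ge> N \<Longrightarrow> \<bar>x (r k) \<bullet> y - a\<bar> < e"
        using a \<open>0 < e\<close> by (auto simp: LIMSEQ_iff)
      have set: "{z. \<bar>z \<bullet> y - a\<bar> \<le> e} = {z. y \<bullet> z \<le> a + e} \<inter> {z. y \<bullet> z \<ge> a - e}"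
        by (auto simp: inner_commute)
      have "K N \<subseteq> {z. \<bar>z \<bullet> y - a\<bar> \<le> e}"
        unfolding K_def
      proof (intro closure_minimal hull_minimal)
        show "(\<lambda>k. x (r k)) ` {N..} \<subseteq> {z. \<bar>z \<bullet> y - a\<bar> \<le> e}"
          using N by (auto simp: less_imp_le)
        show "convex {z. \<bar>z \<bullet> y - a\<bar> \<le> e}" unfolding set
          by (intro convex_Int convex_halfspace_le convex_halfspace_ge)
        show "closed {z. \<bar>z \<bullet> y - a\<bar> \<le> e}" unfolding set
          by (intro closed_Int closed_halfspace_le closed_halfspace_ge)
      qed
      then show ?thesis using l[of N] by blast
    qed
    then have "\<bar>l \<bullet> y - a\<bar> \<le> 0" by (rule field_le_epsilon) simp
    then show ?thesis using a by simp
  qed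
  then have "weakly_tendsto (x \<circ> r) l" by (simp add: weakly_tendsto_iff)
  with r(1) show thesis by (rule that)
qed

section \<open>Radial, normal and critical cones\<close>

lemma radial_cone_iff: "w \<in> radial_cone C x \<longleftrightarrow> (\<exists>t>0. x + t *\<^sub>R w \<in> C)"
proof
  assume "w \<in> radial_cone C x"
  then obtain t y where "0 < t" "y \<in> C" "w = (y - x) /\<^sub>R t" by (auto simp: radial_cone_def)
  then show "\<exists>t>0. x + t *\<^sub>R w \<in> C" by (intro exI[of _ t]) simp
next
  assume "\<exists>t>0. x + t *\<^sub>R w \<in> C"
  then obtain t where t: "0 < t" "x + t *\<^sub>R w \<in> C" by blast
  then have "w = ((x + t *\<^sub>R w) - x) /\<^sub>R t" by simp
  with t show "w \<in> radial_cone C x" unfolding radial_cone_def by blast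
qed

lemma segment_in_convex:
  fixes x w :: "'a::real_vector"
  assumes "convex C" "x \<in> C" "x + t *\<^sub>R w \<in> C" "0 \<le> r" "r \<le> t"
  shows "x + r *\<^sub>R w \<in> C"
proof (cases "t = 0")
  case False
  have "(1 - r / t) *\<^sub>R x + (r / t) *\<^sub>R (x + t *\<^sub>R w) \<in> C"
    using assms False by (intro convexD) auto
  then show ?thesis using False by (simp add: algebra_simps)
qed (use assms in auto)

lemma convex_radial_cone:
  assumes "convex C" "x \<in> C"
  shows "convex (radial_cone C x)"
proof (rule convexI)
  fix v w and a b :: real
  assume *: "v \<in> radial_cone C x" "w \<in> radial_cone C x" "0 \<le> a" "0 \<le> b" "a + b = 1"
  then obtain s t where st: "0 < s" "x + s *\<^sub>R v \<in> C" "0 < t" "x + t *\<^sub>R w \<in> C"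
    by (auto simp: radial_cone_iff)
  define r where "r = min s t"
  have "x + r *\<^sub>R v \<in> C" "x + r *\<^sub>R w \<in> C" "0 < r"
    using segment_in_convex[OF assms st(2), of r] segment_in_convex[OF assms st(4), of r] st
    by (auto simp: r_def)
  then have "a *\<^sub>R (x + r *\<^sub>R v) + b *\<^sub>R (x + r *\<^sub>R w) \<in> C"
    using * by (intro convexD[OF assms(1)]) auto
  also have "a *\<^sub>R (x + r *\<^sub>R v) + b *\<^sub>R (x + r *\<^sub>R w) = (a + b) *\<^sub>R x + r *\<^sub>R (a *\<^sub>R v + b *\<^sub>R w)"
    by (simp add: algebra_simps)
  finally have "x + r *\<^sub>R (a *\<^sub>R v + b *\<^sub>R w) \<in> C" using * by simp
  then show "a *\<^sub>R v + b *\<^sub>R w \<in> radial_cone C x" using \<open>0 < r\<close> by (auto simp: radial_cone_iff)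
qed

lemma normal_coneD: "v \<in> normal_cone C x \<Longrightarrow> x \<in> C" "v \<in> normal_cone C x \<Longrightarrow> y \<in> C \<Longrightarrow> v \<bullet> (y - x) \<le> 0"
  by (auto simp: normal_cone_def split: if_splits)

lemma normal_cone_monotone:
  assumes "v \<in> normal_cone C x" "w \<in> normal_cone C y"
  shows "0 \<le> (v - w) \<bullet> (x - y)"
  using normal_coneD(2)[OF assms(1) normal_coneD(1)[OF assms(2)]]
    normal_coneD(2)[OF assms(2) normal_coneD(1)[OF assms(1)]]
  by (simp add: inner_diff_left inner_diff_right)

lemma critical_cone_iff: "w \<in> critical_cone C x v \<longleftrightarrow> w \<in> tangent_cone C x \<and> v \<bullet> w = 0"
  by (simp add: critical_cone_def orthogonal_comp_def orthogonal_def)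

lemma critical_cone_scale:
  assumes "w \<in> critical_cone C x v" "0 < c"
  shows "c *\<^sub>R w \<in> critical_cone C x v"
proof -
  have "c *\<^sub>R y \<in> radial_cone C x" if y: "y \<in> radial_cone C x" for y
  proof -
    obtain t where t: "0 < t" "x + t *\<^sub>R y \<in> C" using y by (auto simp: radial_cone_iff)
    then show ?thesis using assms(2) unfolding radial_cone_iff
      by (intro exI[of _ "t / c"]) simp
  qed
  then have "(*\<^sub>R) c ` radial_cone C x \<subseteq> radial_cone C x" by blast
  then have "(*\<^sub>R) c ` closure (radial_cone C x) \<subseteq> closure (radial_cone C x)"
    by (metis closure_mono closure_scaleR)
  then show ?thesis using assms(1) by (auto simp: critical_cone_iff tangent_cone_def)
qed

lemma weakly_lsc_limit_le:
  assumes "weakly_lsc Q" "weakly_tendsto u l" "a \<longlonglongrightarrow> c" "\<And>k. Q (u k) \<le> a k"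
  shows "Q l \<le> c"
proof (rule field_le_epsilon)
  fix e :: real assume "0 < e"
  then have "\<forall>\<^sub>F k in sequentially. a k < c + e" using order_tendstoD(2)[OF assms(3)] by simp
  then have "\<forall>\<^sub>F k in sequentially. u k \<in> {x. Q x \<le> c + e}"
    by eventually_elim (use assms(4) order.strict_trans1 less_imp_le in blast)
  then have "l \<in> {x. Q x \<le> c + e}"
    using assms(1,2) unfolding weakly_lsc_def
    by (intro limitin_closedin[OF assms(2)]) auto
  then show "Q l \<le> c + e" by simp
qed

lemma weakly_tendsto_inner:
  assumes "weakly_tendsto u l"
  shows "(\<lambda>k. y \<bullet> u k) \<longlonglongrightarrow> y \<bullet> l"
  using assms by (simp add: weakly_tendsto_iff inner_commute[of y])

text \<open>Moving inside the graph of the normal cone forces criticality. The inequality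
  \<open>n \<bullet> \<xi> \<le> 0\<close> uses the normal at the base point, and \<open>0 \<le> n \<bullet> \<xi>\<close> the normals at the
  moving points; this is why one-sided quotients and weak limits suffice.\<close>

lemma difference_quotient_weak_limit:
  fixes C :: "'a::{real_inner, complete_space} set"
  assumes "convex C" and n: "n \<in> normal_cone C x" and nk: "\<And>k. nk k \<in> normal_cone C (xk k)"
    and t: "\<And>k. 0 < t k" and q: "\<And>k. q k = (xk k - x) /\<^sub>R t k" and B: "\<And>k. norm (q k) \<le> B"
    and lim: "nk \<longlonglongrightarrow> n" and w: "weakly_tendsto q \<xi>"
  shows "\<xi> \<in> critical_cone C x n"
proof -
  have xC: "x \<in> C" "\<And>k. xk k \<in> C"
    using normal_coneD(1)[OF n] normal_coneD(1)[OF nk] .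
  have "x + t k *\<^sub>R q k \<in> C" for k
    using t[of k] xC(2)[of k] by (simp add: q[of k])
  then have "q k \<in> radial_cone C x" for k
    using t[of k] radial_cone_iff by blast
  then have "q k \<in> tangent_cone C x" for k
    unfolding tangent_cone_def using closure_subset by blast
  then have "\<xi> \<in> tangent_cone C x"
    using weak_limit_in_closed_convex[OF _ _ _ w] convex_closure[OF convex_radial_cone[OF assms(1) xC(1)]]
    by (metis closed_closure tangent_cone_def)
  moreover have "n \<bullet> \<xi> \<le> 0"
  proof (rule LIMSEQ_le_const2[OF weakly_tendsto_inner[OF w]])
    show "\<exists>N. \<forall>k\<ge>N. n \<bullet> q k \<le> 0"
      using normal_coneD(2)[OF n xC(2)] t by (simp add: q mult_nonneg_nonpos less_imp_le)
  qed
  moreover have "0 \<le> n \<bullet> \<xi>"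
  proof -
    have ge: "- (norm (nk k - n) * B) \<le> n \<bullet> q k" for k
    proof -
      have "0 \<le> nk k \<bullet> q k"
        using normal_coneD(2)[OF nk[of k] xC(1)] t[of k] by (simp add: q inner_diff_right)
      moreover have "(nk k - n) \<bullet> q k \<le> norm (nk k - n) * B"
        using norm_cauchy_schwarz[of "nk k - n" "q k"] mult_left_mono[OF B[of k] norm_ge_zero[of "nk k - n"]]
        by linarith
      ultimately show ?thesis by (simp add: inner_diff_left)
    qed
    have "(\<lambda>k. - (norm (nk k - n) * B)) \<longlonglongrightarrow> - (norm (n - n) * B)"
      by (intro tendsto_intros lim)
    then show ?thesis
      using LIMSEQ_le[OF _ weakly_tendsto_inner[OF w, of n]] ge by fastforce
  qed
  ultimately show ?thesis by (simp add: critical_cone_iff)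
qed

section \<open>Strongly monotone local solvability\<close>

text \<open>A quantitative localization of the inverse of \<open>\<lambda>x. B x + normal_cone C x\<close> near \<open>(yb, xb)\<close>.
  Coupling the radii as \<open>\<kappa> * s\<close> and \<open>s\<close> matches the Lipschitz constant
  \<open>1 / \<kappa>\<close> of the solution map, so that perturbations by maps of Lipschitz constant \<open>\<mu>\<close> change the
  modulus to \<open>\<kappa> - \<mu>\<close> and leave \<open>s\<close> as it is.\<close>

definition strong_solvability ::
    "'a::real_inner set \<Rightarrow> ('a \<Rightarrow> 'a) \<Rightarrow> real \<Rightarrow> real \<Rightarrow> 'a \<Rightarrow> 'a \<Rightarrow> bool" where
  "strong_solvability C B \<kappa> s xb yb \<longleftrightarrow>
     0 < s \<and> yb - B xb \<in> normal_cone C xb \<and>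
     (\<forall>y\<in>ball yb (\<kappa> * s). \<exists>x\<in>ball xb s. y - B x \<in> normal_cone C x) \<and>
     (\<forall>x1\<in>ball xb s. \<forall>x2\<in>ball xb s. \<forall>y1\<in>ball yb (\<kappa> * s). \<forall>y2\<in>ball yb (\<kappa> * s).
        y1 - B x1 \<in> normal_cone C x1 \<longrightarrow> y2 - B x2 \<in> normal_cone C x2 \<longrightarrow>
        \<kappa> * (norm (x1 - x2))\<^sup>2 \<le> (y1 - y2) \<bullet> (x1 - x2))"

lemma strong_solvability_mono:
  assumes "strong_solvability C B \<kappa> s xb yb"
    and "x1 \<in> ball xb s" "x2 \<in> ball xb s" "y1 \<in> ball yb (\<kappa> * s)" "y2 \<in> ball yb (\<kappa> * s)"
    and "y1 - B x1 \<in> normal_cone C x1" "y2 - B x2 \<in> normal_cone C x2"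
  shows "\<kappa> * (norm (x1 - x2))\<^sup>2 \<le> (y1 - y2) \<bullet> (x1 - x2)"
  using assms(1)[unfolded strong_solvability_def, THEN conjunct2, THEN conjunct2, THEN conjunct2] assms(2-)
  by metis

lemma norm_le_of_square_le_inner:
  fixes d e :: "'a::real_inner"
  assumes "\<kappa> * (norm d)\<^sup>2 \<le> e \<bullet> d"
  shows "\<kappa> * norm d \<le> norm e"
proof (cases "d = 0")
  case False
  have "(\<kappa> * norm d) * norm d \<le> norm e * norm d"
    using assms norm_cauchy_schwarz[of e d] by (simp add: power2_eq_square mult.assoc)
  then show ?thesis using False by simp
qed simp

lemma strong_solvability_lipschitz:
  assumes "strong_solvability C B \<kappa> s xb yb"
    and "x1 \<in> ball xb s" "x2 \<in> ball xb s" "y1 \<in> ball yb (\<kappa> * s)" "y2 \<in> ball yb (\<kappa> * s)"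
    and "y1 - B x1 \<in> normal_cone C x1" "y2 - B x2 \<in> normal_cone C x2"
  shows "\<kappa> * norm (x1 - x2) \<le> norm (y1 - y2)"
  by (rule norm_le_of_square_le_inner[OF strong_solvability_mono[OF assms]])

text \<open>With \<open>\<theta>\<close> the local solution map for \<open>B\<close>, solutions of the perturbed inclusion are the fixed points of
  \<open>\<lambda>x. \<theta> (v - g x)\<close>, a contraction with constant \<open>\<mu> / \<kappa>\<close> of a slightly smaller closed ball.\<close>

lemma strong_solvability_perturb:
  fixes C :: "'a::{real_inner, complete_space} set"
  assumes ss: "strong_solvability C B \<kappa> s xb yb" and \<mu>: "0 \<le> \<mu>" "\<mu> < \<kappa>"
    and g: "\<And>x x'. x \<in> ball xb s \<Longrightarrow> x' \<in> ball xb s \<Longrightarrow> norm (g x - g x') \<le> \<mu> * norm (x - x')"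
  shows "strong_solvability C (\<lambda>x. B x + g x) (\<kappa> - \<mu>) s xb (yb + g xb)"
proof -
  note lip = strong_solvability_lipschitz[OF ss]
  have s: "0 < s" and base: "yb - B xb \<in> normal_cone C xb"
    and ex: "\<And>y. y \<in> ball yb (\<kappa> * s) \<Longrightarrow> \<exists>x. x \<in> ball xb s \<and> y - B x \<in> normal_cone C x"
    using ss unfolding strong_solvability_def by blast+
  have \<kappa>s: "0 < \<kappa> * s" using s \<mu> by simp
  have shift: "norm (v - g x - yb) \<le> norm (v - (yb + g xb)) + \<mu> * norm (x - xb)" if "x \<in> ball xb s" for v x
  proof -
    have "norm ((v - (yb + g xb)) - (g x - g xb)) \<le> norm (v - (yb + g xb)) + norm (g x - g xb)"
      by (rule norm_triangle_ineq4)
    also have "\<dots> \<le> norm (v - (yb + g xb)) + \<mu> * norm (x - xb)"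
      using g[OF that, of xb] s by simp
    finally show ?thesis by (simp add: algebra_simps)
  qed
  have in_ball: "v - g x \<in> ball yb (\<kappa> * s)" if "x \<in> ball xb s" "v \<in> ball (yb + g xb) ((\<kappa> - \<mu>) * s)" for v x
  proof -
    have "\<mu> * norm (x - xb) \<le> \<mu> * s"
      using that \<mu> by (intro mult_left_mono) (auto simp: dist_norm norm_minus_commute)
    then show ?thesis
      using shift[OF that(1), of v] that(2) by (simp add: dist_norm norm_minus_commute algebra_simps)
  qed
  have "\<exists>x\<in>ball xb s. v - (B x + g x) \<in> normal_cone C x" if v: "v \<in> ball (yb + g xb) ((\<kappa> - \<mu>) * s)" for v
  proof -
    obtain \<theta> where \<theta>: "\<And>y. y \<in> ball yb (\<kappa> * s) \<Longrightarrow> \<theta> y \<in> ball xb s \<and> y - B (\<theta> y) \<in> normal_cone C (\<theta> y)"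
      using ex by metis
    \<comment> \<open>The smallest radius for which the contraction maps the closed ball into itself; it is
      strictly below \<open>s\<close>.\<close>
    define r where "r = norm (v - (yb + g xb)) / (\<kappa> - \<mu>)"
    have r: "0 \<le> r" "r < s" "norm (v - (yb + g xb)) = (\<kappa> - \<mu>) * r"
      using v \<mu> by (auto simp: r_def field_simps dist_norm norm_minus_commute)
    have sub: "x \<in> ball xb s" if "x \<in> cball xb r" for x using that r by auto
    have "\<exists>!x\<in>cball xb r. \<theta> (v - g x) = x"
    proof (rule Banach_fix[where c = "\<mu> / \<kappa>" and f = "\<lambda>x. \<theta> (v - g x)"])
      show "complete (cball xb r)" by (simp add: complete_eq_closed)
      show "cball xb r \<noteq> {}" using r by simp
      show "0 \<le> \<mu> / \<kappa>" "\<mu> / \<kappa> < 1" using \<mu> by auto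
      show "(\<lambda>x. \<theta> (v - g x)) ` cball xb r \<subseteq> cball xb r"
      proof clarify
        fix x assume x: "x \<in> cball xb r"
        have "\<kappa> * norm (\<theta> (v - g x) - xb) \<le> norm (v - g x - yb)"
          using \<theta>[OF in_ball[OF sub[OF x] v]] in_ball[OF sub[OF x] v] base s \<kappa>s
          by (intro lip) auto
        also have "\<dots> \<le> (\<kappa> - \<mu>) * r + \<mu> * norm (x - xb)" using shift[OF sub[OF x], of v] r by simp
        also have "\<dots> \<le> (\<kappa> - \<mu>) * r + \<mu> * r"
          using x \<mu> by (intro add_left_mono mult_left_mono) (auto simp: dist_norm norm_minus_commute)
        also have "\<dots> = \<kappa> * r" by (simp add: algebra_simps)
        finally show "\<theta> (v - g x) \<in> cball xb r" using \<mu> by (simp add: dist_norm norm_minus_commute)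
      qed
      show "dist (\<theta> (v - g x)) (\<theta> (v - g y)) \<le> \<mu> / \<kappa> * dist x y"
        if "x \<in> cball xb r" "y \<in> cball xb r" for x y
      proof -
        from that have xy: "x \<in> cball xb r" "y \<in> cball xb r" .
        have "\<kappa> * norm (\<theta> (v - g x) - \<theta> (v - g y)) \<le> norm ((v - g x) - (v - g y))"
          using \<theta> in_ball[OF sub v] xy by (intro lip) auto
        also have "\<dots> = norm (g y - g x)" by simp
        also have "\<dots> \<le> \<mu> * norm (y - x)" using g sub xy by blast
        finally show "dist (\<theta> (v - g x)) (\<theta> (v - g y)) \<le> \<mu> / \<kappa> * dist x y"
          using \<mu> by (simp add: dist_norm field_simps norm_minus_commute)
      qed
    qed
    then obtain x where x: "x \<in> cball xb r" "\<theta> (v - g x) = x" by blast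
    then have "v - g x - B x \<in> normal_cone C x" using \<theta>[OF in_ball[OF sub[OF x(1)] v]] by simp
    then show ?thesis using sub[OF x(1)] by (intro bexI[of _ x]) (simp_all add: algebra_simps)
  qed
  moreover have "(\<kappa> - \<mu>) * (norm (x1 - x2))\<^sup>2 \<le> (v1 - v2) \<bullet> (x1 - x2)"
    if x: "x1 \<in> ball xb s" "x2 \<in> ball xb s"
      and v: "v1 \<in> ball (yb + g xb) ((\<kappa> - \<mu>) * s)" "v2 \<in> ball (yb + g xb) ((\<kappa> - \<mu>) * s)"
      and n: "v1 - (B x1 + g x1) \<in> normal_cone C x1" "v2 - (B x2 + g x2) \<in> normal_cone C x2" for x1 x2 v1 v2
  proof -
    have "v1 - g x1 - B x1 \<in> normal_cone C x1" "v2 - g x2 - B x2 \<in> normal_cone C x2"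
      using n by (simp_all add: algebra_simps)
    then have "\<kappa> * (norm (x1 - x2))\<^sup>2 \<le> ((v1 - g x1) - (v2 - g x2)) \<bullet> (x1 - x2)"
      by (rule strong_solvability_mono[OF ss x in_ball[OF x(1) v(1)] in_ball[OF x(2) v(2)]])
    also have "\<dots> = (v1 - v2) \<bullet> (x1 - x2) - (g x1 - g x2) \<bullet> (x1 - x2)"
      by (simp add: algebra_simps)
    also have "\<dots> \<le> (v1 - v2) \<bullet> (x1 - x2) + \<mu> * (norm (x1 - x2))\<^sup>2"
    proof -
      have "\<bar>(g x1 - g x2) \<bullet> (x1 - x2)\<bar> \<le> norm (g x1 - g x2) * norm (x1 - x2)" by (rule Cauchy_Schwarz_ineq2)
      also have "\<dots> \<le> (\<mu> * norm (x1 - x2)) * norm (x1 - x2)" by (intro mult_right_mono g x) auto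
      finally show ?thesis by (simp add: power2_eq_square)
    qed
    finally show ?thesis by (simp add: algebra_simps)
  qed
  moreover have "(yb + g xb) - (B xb + g xb) \<in> normal_cone C xb" using base by simp
  ultimately show ?thesis unfolding strong_solvability_def using s by blast
qed

text \<open>For \<open>B\<close> a multiple of the identity, the solution is the metric projection of \<open>y /\<^sub>R l\<close> onto \<open>C\<close>.\<close>

lemma strong_solvability_scaled_identity:
  fixes C :: "'a::{real_inner, complete_space} set"
  assumes C: "closed C" "convex C" and v: "v \<in> normal_cone C xb" and l: "0 < l" and s: "0 < s"
  shows "strong_solvability C (\<lambda>x. l *\<^sub>R x) l s xb (v + l *\<^sub>R xb)"
proof -
  have mono: "l * (norm (x1 - x2))\<^sup>2 \<le> (y1 - y2) \<bullet> (x1 - x2)"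
    if "y1 - l *\<^sub>R x1 \<in> normal_cone C x1" "y2 - l *\<^sub>R x2 \<in> normal_cone C x2" for x1 x2 y1 y2
    using normal_cone_monotone[OF that] by (simp add: power2_norm_eq_inner algebra_simps)
  have base: "(v + l *\<^sub>R xb) - l *\<^sub>R xb \<in> normal_cone C xb" using v by simp
  have "\<exists>x\<in>ball xb s. y - l *\<^sub>R x \<in> normal_cone C x" if y: "y \<in> ball (v + l *\<^sub>R xb) (l * s)" for y
  proof -
    have "C \<noteq> {}" using normal_coneD(1)[OF v] by blast
    then obtain x where x: "x \<in> C" "\<And>z. z \<in> C \<Longrightarrow> (y /\<^sub>R l - x) \<bullet> (z - x) \<le> 0"
      using hilbert_projection[OF C] by metis
    have "(y - l *\<^sub>R x) \<bullet> (z - x) \<le> 0" if "z \<in> C" for z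
    proof -
      have "y - l *\<^sub>R x = l *\<^sub>R (y /\<^sub>R l - x)" using l by (simp add: algebra_simps)
      then have "(y - l *\<^sub>R x) \<bullet> (z - x) = l * ((y /\<^sub>R l - x) \<bullet> (z - x))" by simp
      then show ?thesis using x(2)[OF that] l by (simp add: mult_nonneg_nonpos)
    qed
    then have n: "y - l *\<^sub>R x \<in> normal_cone C x" using x(1) by (simp add: normal_cone_def)
    have "l * norm (x - xb) \<le> norm (y - (v + l *\<^sub>R xb))"
      by (rule norm_le_of_square_le_inner[OF mono[OF n base]])
    also have "\<dots> < l * s" using y by (simp add: dist_norm norm_minus_commute)
    finally have "x \<in> ball xb s" using l by (simp add: dist_norm norm_minus_commute)
    with n show ?thesis by blast
  qed
  then show ?thesis unfolding strong_solvability_def using s base mono by blast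
qed

section \<open>Improving the modulus along solution curves\<close>

text \<open>Substitute for integrating a derivative that may exist nowhere: the largest \<open>t\<close>
  with \<open>\<phi> 0 - \<epsilon> * t \<le> \<phi> t\<close> cannot be smaller than \<open>1\<close>.\<close>

lemma lower_Dini_nonneg_imp_le:
  fixes \<phi> :: "real \<Rightarrow> real"
  assumes cont: "continuous_on {0..1} \<phi>"
    and dini: "\<And>t \<epsilon>. 0 \<le> t \<Longrightarrow> t < 1 \<Longrightarrow> 0 < \<epsilon> \<Longrightarrow>
      \<exists>\<delta>>0. \<forall>s. t < s \<and> s < t + \<delta> \<and> s \<le> 1 \<longrightarrow> - \<epsilon> * (s - t) \<le> \<phi> s - \<phi> t"
  shows "\<phi> 0 \<le> \<phi> 1"
proof (rule field_le_epsilon)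
  fix \<epsilon> :: real assume "0 < \<epsilon>"
  define S where "S = {t\<in>{0..1}. \<phi> 0 - \<epsilon> * t \<le> \<phi> t}"
  have "closed S" unfolding S_def
    by (intro continuous_on_closed_Collect_le cont continuous_intros closed_atLeastAtMost)
  moreover have "bounded S" by (rule bounded_subset[of "{0..1}"]) (auto simp: S_def)
  ultimately have "compact S" by (simp add: compact_eq_bounded_closed)
  moreover have "0 \<in> S" by (simp add: S_def)
  ultimately obtain t where t: "t \<in> S" "\<And>s. s \<in> S \<Longrightarrow> s \<le> t"
    using compact_attains_sup[of S] by blast
  have "t = 1"
  proof (rule ccontr)
    assume "t \<noteq> 1"
    then have t01: "0 \<le> t" "t < 1" using t(1) by (auto simp: S_def)
    obtain \<delta> where \<delta>: "0 < \<delta>" "\<And>s. t < s \<Longrightarrow> s < t + \<delta> \<Longrightarrow> s \<le> 1 \<Longrightarrow> - \<epsilon> * (s - t) \<le> \<phi> s - \<phi> t"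
      using dini[OF t01 \<open>0 < \<epsilon>\<close>] by blast
    define s where "s = min (t + \<delta> / 2) 1"
    have s: "t < s" "s < t + \<delta>" "s \<le> 1" using \<delta>(1) t01 by (auto simp: s_def)
    have "s \<in> S" using \<delta>(2)[OF s] t(1) s t01 by (auto simp: S_def algebra_simps)
    then show False using t(2) s(1) by force
  qed
  then show "\<phi> 0 \<le> \<phi> 1 + \<epsilon>" using t(1) by (simp add: S_def)
qed

definition positive_on_critical_cones ::
    "'a::real_inner set \<Rightarrow> ('a \<Rightarrow>\<^sub>L 'a) \<Rightarrow> real \<Rightarrow> real \<Rightarrow> 'a \<Rightarrow> 'a \<Rightarrow> bool" where
  "positive_on_critical_cones C A \<kappa> \<eta> xb nb \<longleftrightarrow>
     (\<forall>x n w. n \<in> normal_cone C x \<and> norm (x - xb) < \<eta> \<and> norm (n - nb) < \<eta> \<and>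
        w \<in> critical_cone C x n \<longrightarrow> \<kappa> * (norm w)\<^sup>2 \<le> blinfun_apply A w \<bullet> w)"

text \<open>The modulus of strong monotonicity depends only on the quadratic form on critical cones. Let \<open>y\<close> run
  through a segment from \<open>y1\<close> to \<open>y2 = y1 + \<Delta>\<close> and let \<open>x\<close> be the solution curve. A weak limit \<open>\<xi>\<close> of
  its difference quotients is critical and satisfies \<open>\<kappa> * (norm \<xi>)\<^sup>2 \<le> A \<xi> \<bullet> \<xi> \<le> \<Delta> \<bullet> \<xi>\<close>. For
  \<open>u = x 1 - x 0\<close> this gives
  \<open>0 \<le> \<kappa> * (norm (\<xi> - u))\<^sup>2 \<le> \<Delta> \<bullet> \<xi> - 2 * \<kappa> * (u \<bullet> \<xi>) + \<kappa> * (norm u)\<^sup>2\<close>, an inequality affine in \<open>\<xi>\<close>.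
  Its right side is the limit of the corresponding quotients of the scalar function \<open>\<phi>\<close> below, and
  \<open>\<phi> 0 \<le> \<phi> 1\<close> is exactly \<open>\<kappa> * (norm u)\<^sup>2 \<le> \<Delta> \<bullet> u\<close>. Only scalar functions are
  integrated, which avoids differentiating Lipschitz curves in Hilbert space.\<close>

lemma strong_solvability_improve:
  fixes C :: "'a::{real_inner, complete_space} set" and A :: "'a \<Rightarrow>\<^sub>L 'a"
  assumes C: "convex C" and lsc: "weakly_lsc (\<lambda>w. blinfun_apply A w \<bullet> w)"
    and \<kappa>: "0 < \<kappa>" and \<eta>: "0 < \<eta>"
    and pos: "positive_on_critical_cones C A \<kappa> \<eta> xb nb"
    and l: "0 \<le> l" and \<kappa>1: "0 < \<kappa>1"
    and ss: "strong_solvability C (\<lambda>x. blinfun_apply A x + l *\<^sub>R x) \<kappa>1 s xb yb"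
    and yb: "yb = nb + (blinfun_apply A xb + l *\<^sub>R xb)"
  shows "\<exists>s>0. strong_solvability C (\<lambda>x. blinfun_apply A x + l *\<^sub>R x) \<kappa> s xb yb"
proof -
  define B where "B x = blinfun_apply A x + l *\<^sub>R x" for x
  have ssB: "strong_solvability C B \<kappa>1 s xb yb" using ss by (simp add: B_def[abs_def])
  note lip = strong_solvability_lipschitz[OF ssB]
  have s: "0 < s" and base: "yb - B xb \<in> normal_cone C xb"
    and ex: "\<And>y. y \<in> ball yb (\<kappa>1 * s) \<Longrightarrow> \<exists>x. x \<in> ball xb s \<and> y - B x \<in> normal_cone C x"
    using ssB unfolding strong_solvability_def by blast+
  obtain X where X: "\<And>y. y \<in> ball yb (\<kappa>1 * s) \<Longrightarrow> X y \<in> ball xb s"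
      "\<And>y. y \<in> ball yb (\<kappa>1 * s) \<Longrightarrow> y - B (X y) \<in> normal_cone C (X y)"
    using ex by metis
  have B_lip: "norm (B x - B x') \<le> (norm A + l) * norm (x - x')" for x x'
  proof -
    have "B x - B x' = blinfun_apply A (x - x') + l *\<^sub>R (x - x')"
      by (simp add: B_def blinfun.diff_right algebra_simps)
    also have "norm \<dots> \<le> norm (blinfun_apply A (x - x')) + norm (l *\<^sub>R (x - x'))"
      by (rule norm_triangle_ineq)
    also have "\<dots> \<le> norm A * norm (x - x') + l * norm (x - x')"
      using norm_blinfun[of A "x - x'"] l by simp
    finally show ?thesis by (simp add: algebra_simps)
  qed
  \<comment> \<open>The radius \<open>s0\<close> is chosen such that the solutions for \<open>y\<close> within \<open>\<kappa>1 * s0\<close> of \<open>yb\<close>, together with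
    their normals, stay in the region where positivity on critical cones is known.\<close>
  define c where "c = 1 + \<kappa>1 + norm A + l"
  have c: "1 \<le> c" using \<kappa>1 l by (simp add: c_def)
  define s0 where "s0 = min s (\<eta> / c)"
  have s0: "0 < s0" "s0 \<le> s" "c * s0 \<le> \<eta>" using s \<eta> c by (auto simp: s0_def min_def field_simps)
  define \<rho> where "\<rho> = \<kappa>1 * s0"
  have \<rho>: "0 < \<rho>" "ball yb \<rho> \<subseteq> ball yb (\<kappa>1 * s)"
    using s0 \<kappa>1 by (auto simp: \<rho>_def intro!: subset_ball mult_left_mono)
  have X_lip: "\<kappa>1 * norm (X y - X y') \<le> norm (y - y')" if "y \<in> ball yb \<rho>" "y' \<in> ball yb \<rho>" for y y'
    using that \<rho>(2) X by (intro lip) auto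
  have X_near: "\<kappa>1 * norm (X y - xb) \<le> norm (y - yb)" if "y \<in> ball yb \<rho>" for y
    using that \<rho> s base \<kappa>1 X by (intro lip) auto
  have near: "norm (X y - xb) < \<eta>" "norm ((y - B (X y)) - nb) < \<eta>" if y: "y \<in> ball yb \<rho>" for y
  proof -
    have yb': "norm (y - yb) < \<kappa>1 * s0" using y by (simp add: \<rho>_def dist_norm norm_minus_commute)
    then have x: "norm (X y - xb) < s0" using X_near[OF y] \<kappa>1 by (smt (verit) mult_less_cancel_left_pos)
    have "s0 \<le> c * s0" using c s0 by simp
    then show "norm (X y - xb) < \<eta>" using x s0 by linarith
    have "(y - B (X y)) - nb = (y - yb) - (B (X y) - B xb)" by (simp add: yb B_def)
    then have "norm ((y - B (X y)) - nb) \<le> norm (y - yb) + norm (B (X y) - B xb)"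
      by (metis norm_triangle_ineq4)
    also have "\<dots> \<le> norm (y - yb) + (norm A + l) * norm (X y - xb)" using B_lip by simp
    also have "\<dots> < \<kappa>1 * s0 + (norm A + l) * s0 + s0"
      using yb' x mult_left_mono[of "norm (X y - xb)" s0 "norm A + l"] l s0 by simp
    also have "\<dots> = c * s0" by (simp add: c_def algebra_simps)
    finally show "norm ((y - B (X y)) - nb) < \<eta>" using s0 by linarith
  qed
  have key: "\<kappa> * (norm (X y2 - X y1))\<^sup>2 \<le> (y2 - y1) \<bullet> (X y2 - X y1)"
    if y12: "y1 \<in> ball yb \<rho>" "y2 \<in> ball yb \<rho>" for y1 y2
  proof -
    define \<Delta> where "\<Delta> = y2 - y1"
    define y where "y t = y1 + t *\<^sub>R \<Delta>" for t :: real
    define x where "x t = X (y t)" for t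
    define N where "N t = y t - B (x t)" for t
    define u where "u = x 1 - x 0"
    have y_in: "y t \<in> ball yb \<rho>" if "0 \<le> t" "t \<le> 1" for t
    proof -
      have "(1 - t) *\<^sub>R y1 + t *\<^sub>R y2 \<in> ball yb \<rho>"
        using y12 that by (intro convexD[OF convex_ball]) auto
      then show ?thesis by (simp add: y_def \<Delta>_def algebra_simps)
    qed
    have N: "N t \<in> normal_cone C (x t)" if "0 \<le> t" "t \<le> 1" for t
      unfolding N_def x_def using X(2) y_in[OF that] \<rho>(2) by blast
    have x_lip: "norm (x t - x r) \<le> (norm \<Delta> / \<kappa>1) * \<bar>t - r\<bar>"
      if "0 \<le> t" "t \<le> 1" "0 \<le> r" "r \<le> 1" for t r
    proof -
      have "y t - y r = (t - r) *\<^sub>R \<Delta>" by (simp add: y_def algebra_simps)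
      then have "norm (y t - y r) = norm \<Delta> * \<bar>t - r\<bar>" by (simp add: mult.commute)
      then show ?thesis
        using X_lip[OF y_in[OF that(1,2)] y_in[OF that(3,4)]] \<kappa>1
        by (simp add: x_def pos_le_divide_eq mult.commute)
    qed
    have x_cont: "continuous_on {0..1} x"
    proof (rule lipschitz_on_continuous_on)
      show "(norm \<Delta> / \<kappa>1)-lipschitz_on {0..1} x"
        using x_lip \<kappa>1 by (intro lipschitz_onI) (auto simp: dist_norm)
    qed
    define \<phi> where "\<phi> t = \<Delta> \<bullet> x t - 2 * \<kappa> * (u \<bullet> x t) + \<kappa> * (norm u)\<^sup>2 * t" for t
    have "\<phi> 0 \<le> \<phi> 1"
    proof (rule lower_Dini_nonneg_imp_le)
      show "continuous_on {0..1} \<phi>"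
        unfolding \<phi>_def by (intro continuous_intros x_cont)
      fix t \<epsilon> :: real assume t: "0 \<le> t" "t < 1" and \<epsilon>: "0 < \<epsilon>"
      show "\<exists>\<delta>>0. \<forall>s. t < s \<and> s < t + \<delta> \<and> s \<le> 1 \<longrightarrow> - \<epsilon> * (s - t) \<le> \<phi> s - \<phi> t"
      proof (rule ccontr)
        assume neg: "\<not> ?thesis"
        have "\<exists>r. t < r \<and> r < t + 1 / Suc k \<and> r \<le> 1 \<and> \<phi> r - \<phi> t < - \<epsilon> * (r - t)" for k
        proof -
          have "0 < 1 / real (Suc k)" by simp
          then show ?thesis using neg not_le by blast
        qed
        then obtain r where r: "\<And>k. t < r k" "\<And>k. r k < t + 1 / Suc k" "\<And>k. r k \<le> 1"
          and \<phi>r: "\<And>k. \<phi> (r k) - \<phi> t < - \<epsilon> * (r k - t)"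
          by metis
        have r01: "0 \<le> r k" for k using r(1)[of k] t by linarith
        define q where "q k = (x (r k) - x t) /\<^sub>R (r k - t)" for k
        have xq: "x (r k) - x t = (r k - t) *\<^sub>R q k" for k using r(1)[of k] by (simp add: q_def)
        have q_bd: "norm (q k) \<le> norm \<Delta> / \<kappa>1" for k
        proof -
          have "norm (x (r k) - x t) \<le> (norm \<Delta> / \<kappa>1) * (r k - t)"
            using x_lip[OF r01 r(3), of t k] t r(1)[of k] by simp
          then have "norm (q k) * (r k - t) \<le> (norm \<Delta> / \<kappa>1) * (r k - t)"
            using r(1)[of k] unfolding xq by (simp add: mult.commute)
          then show ?thesis using r(1)[of k] by (meson diff_gt_0_iff_gt mult_le_cancel_right_pos)
        qed
        obtain \<sigma> \<xi> where \<sigma>: "strict_mono \<sigma>" and w: "weakly_tendsto (q \<circ> \<sigma>) \<xi>"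
          using bounded_weakly_convergent_subseq[where x = q, OF q_bd] by metis
        have "(\<lambda>k. t + inverse (real (Suc k))) \<longlonglongrightarrow> t + 0"
          by (intro tendsto_intros LIMSEQ_inverse_real_of_nat)
        then have up: "(\<lambda>k. t + inverse (real (Suc k))) \<longlonglongrightarrow> t" by simp
        have "r \<longlonglongrightarrow> t"
        proof (rule real_tendsto_sandwich[OF _ _ tendsto_const up])
          show "\<forall>\<^sub>F k in sequentially. t \<le> r k" using r(1) by (simp add: less_imp_le)
          show "\<forall>\<^sub>F k in sequentially. r k \<le> t + inverse (real (Suc k))"
            using r(2) by (simp add: inverse_eq_divide less_imp_le del: of_nat_Suc)
        qed
        then have r_lim: "(\<lambda>k. r (\<sigma> k)) \<longlonglongrightarrow> t"
          using LIMSEQ_subseq_LIMSEQ[OF _ \<sigma>] by (simp add: o_def)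
        have x_lim: "(\<lambda>k. x (r (\<sigma> k))) \<longlonglongrightarrow> x t"
          using continuous_on_tendsto_compose[OF x_cont r_lim] t r01 r(3) by simp
        have B_cont: "continuous_on UNIV B"
          unfolding B_def by (intro continuous_intros)
        have N_lim: "(\<lambda>k. N (r (\<sigma> k))) \<longlonglongrightarrow> N t"
          unfolding N_def y_def
          by (intro tendsto_intros r_lim continuous_on_tendsto_compose[OF B_cont x_lim]) auto
        have t1: "t \<le> 1" using t by simp
        have crit: "\<xi> \<in> critical_cone C (x t) (N t)"
        proof (rule difference_quotient_weak_limit[OF C])
          show "N t \<in> normal_cone C (x t)" by (rule N[OF t(1) t1])
          show "N (r (\<sigma> k)) \<in> normal_cone C (x (r (\<sigma> k)))" for k by (rule N[OF r01 r(3)])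
          show "0 < r (\<sigma> k) - t" for k using r(1)[of "\<sigma> k"] by simp
          show "(q \<circ> \<sigma>) k = (x (r (\<sigma> k)) - x t) /\<^sub>R (r (\<sigma> k) - t)" for k by (simp add: q_def)
          show "norm ((q \<circ> \<sigma>) k) \<le> norm \<Delta> / \<kappa>1" for k using q_bd by simp
        qed (rule N_lim w)+
        have Aq: "blinfun_apply A (q k) \<bullet> q k \<le> \<Delta> \<bullet> q k - l * (norm (q k))\<^sup>2" for k
        proof -
          define \<tau> where "\<tau> = r k - t"
          have \<tau>: "0 < \<tau>" using r(1)[of k] by (simp add: \<tau>_def)
          have "0 \<le> (N (r k) - N t) \<bullet> (x (r k) - x t)"
            by (rule normal_cone_monotone[OF N[OF r01 r(3)] N[OF t(1) t1]])
          also have "N (r k) - N t = \<tau> *\<^sub>R \<Delta> - (blinfun_apply A (x (r k) - x t) + l *\<^sub>R (x (r k) - x t))"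
            by (simp add: N_def B_def y_def \<tau>_def blinfun.diff_right algebra_simps)
          also have "\<dots> = \<tau> *\<^sub>R (\<Delta> - (blinfun_apply A (q k) + l *\<^sub>R q k))"
            unfolding xq \<tau>_def[symmetric] by (simp add: blinfun.scaleR_right algebra_simps)
          also have "\<dots> \<bullet> (x (r k) - x t)
              = (\<tau> * \<tau>) * (\<Delta> \<bullet> q k - l * (norm (q k))\<^sup>2 - blinfun_apply A (q k) \<bullet> q k)"
            unfolding xq \<tau>_def[symmetric]
            by (simp add: power2_norm_eq_inner inner_diff_left inner_add_left algebra_simps)
          finally have "0 \<le> \<Delta> \<bullet> q k - l * (norm (q k))\<^sup>2 - blinfun_apply A (q k) \<bullet> q k"
            using mult_pos_pos[OF \<tau> \<tau>] by (metis not_le zero_le_mult_iff)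
          then show ?thesis by simp
        qed
        \<comment> \<open>The term \<open>l * (norm (q k))\<^sup>2\<close> is not weakly continuous; it is bounded from below by its
          linearization at \<open>\<xi>\<close>.\<close>
        have Aq': "blinfun_apply A (q k) \<bullet> q k \<le> \<Delta> \<bullet> q k - 2 * l * (\<xi> \<bullet> q k) + l * (norm \<xi>)\<^sup>2" for k
        proof -
          have "0 \<le> l * (norm (q k - \<xi>))\<^sup>2" using l by simp
          then show ?thesis using Aq[of k]
            by (simp add: power2_norm_eq_inner inner_diff_left inner_diff_right inner_commute algebra_simps)
        qed
        have "blinfun_apply A \<xi> \<bullet> \<xi> \<le> \<Delta> \<bullet> \<xi> - 2 * l * (\<xi> \<bullet> \<xi>) + l * (norm \<xi>)\<^sup>2"
        proof (rule weakly_lsc_limit_le[OF lsc w])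
          show "(\<lambda>k. \<Delta> \<bullet> (q \<circ> \<sigma>) k - 2 * l * (\<xi> \<bullet> (q \<circ> \<sigma>) k) + l * (norm \<xi>)\<^sup>2)
              \<longlonglongrightarrow> \<Delta> \<bullet> \<xi> - 2 * l * (\<xi> \<bullet> \<xi>) + l * (norm \<xi>)\<^sup>2"
            by (intro tendsto_intros weakly_tendsto_inner[OF w])
        qed (simp add: Aq')
        also have "\<dots> \<le> \<Delta> \<bullet> \<xi>" using l by (simp add: power2_norm_eq_inner)
        finally have "blinfun_apply A \<xi> \<bullet> \<xi> \<le> \<Delta> \<bullet> \<xi>" .
        moreover have "\<kappa> * (norm \<xi>)\<^sup>2 \<le> blinfun_apply A \<xi> \<bullet> \<xi>"
          using pos N[OF t(1) t1] crit near[OF y_in[OF t(1) t1]]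
          unfolding positive_on_critical_cones_def x_def N_def by blast
        moreover have "0 \<le> \<kappa> * (norm (\<xi> - u))\<^sup>2" using \<kappa> by simp
        ultimately have ge: "0 \<le> \<Delta> \<bullet> \<xi> - 2 * \<kappa> * (u \<bullet> \<xi>) + \<kappa> * (norm u)\<^sup>2"
          by (simp add: power2_norm_eq_inner inner_diff_left inner_diff_right inner_commute algebra_simps)
        have le: "\<Delta> \<bullet> q k - 2 * \<kappa> * (u \<bullet> q k) + \<kappa> * (norm u)\<^sup>2 \<le> - \<epsilon>" for k
        proof -
          have "\<phi> (r k) - \<phi> t = \<Delta> \<bullet> (x (r k) - x t) - 2 * \<kappa> * (u \<bullet> (x (r k) - x t)) + \<kappa> * (norm u)\<^sup>2 * (r k - t)"
            by (simp add: \<phi>_def inner_diff_right algebra_simps)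
          also have "\<dots> = (r k - t) * (\<Delta> \<bullet> q k - 2 * \<kappa> * (u \<bullet> q k) + \<kappa> * (norm u)\<^sup>2)"
            unfolding xq by (simp add: algebra_simps)
          finally have "(r k - t) * (\<Delta> \<bullet> q k - 2 * \<kappa> * (u \<bullet> q k) + \<kappa> * (norm u)\<^sup>2) < (r k - t) * (- \<epsilon>)"
            using \<phi>r[of k] by (simp add: mult.commute)
          then show ?thesis
            using r(1)[of k] by (meson diff_gt_0_iff_gt less_imp_le mult_less_cancel_left_pos)
        qed
        have "(\<lambda>k. \<Delta> \<bullet> (q \<circ> \<sigma>) k - 2 * \<kappa> * (u \<bullet> (q \<circ> \<sigma>) k) + \<kappa> * (norm u)\<^sup>2)
              \<longlonglongrightarrow> \<Delta> \<bullet> \<xi> - 2 * \<kappa> * (u \<bullet> \<xi>) + \<kappa> * (norm u)\<^sup>2"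
          by (intro tendsto_intros weakly_tendsto_inner[OF w])
        then have "\<Delta> \<bullet> \<xi> - 2 * \<kappa> * (u \<bullet> \<xi>) + \<kappa> * (norm u)\<^sup>2 \<le> - \<epsilon>"
          by (rule LIMSEQ_le_const2) (use le in auto)
        then show False using ge \<epsilon> by linarith
      qed
    qed
    then have "0 \<le> \<Delta> \<bullet> u - \<kappa> * (norm u)\<^sup>2"
      by (simp add: \<phi>_def u_def power2_norm_eq_inner inner_diff_left inner_diff_right inner_commute algebra_simps)
    moreover have "u = X y2 - X y1" by (simp add: u_def x_def y_def \<Delta>_def)
    ultimately show ?thesis by (simp add: \<Delta>_def)
  qed
  \<comment> \<open>The domain is restricted so that its radii have the ratio \<open>\<kappa>\<close>.\<close>
  define s' where "s' = min s0 (\<rho> / \<kappa>)"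
  have s': "0 < s'" "s' \<le> s0" "\<kappa> * s' \<le> \<rho>" using s0 \<rho> \<kappa> by (auto simp: s'_def min_def field_simps)
  have balls: "y \<in> ball yb \<rho>" if "y \<in> ball yb (\<kappa> * s')" for y using that s' by auto
  have X_eq: "X y = x" if "x \<in> ball xb s'" "y \<in> ball yb \<rho>" "y - B x \<in> normal_cone C x" for x y
  proof -
    have "\<kappa>1 * norm (X y - x) \<le> norm (y - y)"
      using that \<rho>(2) s' s0 X by (intro lip) auto
    then show ?thesis using \<kappa>1 by (simp add: mult_le_0_iff)
  qed
  have X_xb: "X yb = xb" using X_eq[of xb yb] s' \<rho> base by simp
  have "strong_solvability C B \<kappa> s' xb yb"
    unfolding strong_solvability_def
  proof (intro conjI ballI impI)
    fix y assume y: "y \<in> ball yb (\<kappa> * s')"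
    have "\<kappa> * norm (X y - xb) \<le> norm (y - yb)"
      using key[OF _ balls[OF y], of yb] \<rho> X_xb by (intro norm_le_of_square_le_inner) simp
    also have "\<dots> < \<kappa> * s'" using y by (simp add: dist_norm norm_minus_commute)
    finally have "X y \<in> ball xb s'" using \<kappa> by (simp add: dist_norm norm_minus_commute)
    moreover have "y - B (X y) \<in> normal_cone C (X y)" using X(2) balls[OF y] \<rho>(2) by blast
    ultimately show "\<exists>x\<in>ball xb s'. y - B x \<in> normal_cone C x" by blast
  next
    fix x1 x2 y1 y2
    assume x: "x1 \<in> ball xb s'" "x2 \<in> ball xb s'" and y: "y1 \<in> ball yb (\<kappa> * s')" "y2 \<in> ball yb (\<kappa> * s')"
      and n: "y1 - B x1 \<in> normal_cone C x1" "y2 - B x2 \<in> normal_cone C x2"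
    show "\<kappa> * (norm (x1 - x2))\<^sup>2 \<le> (y1 - y2) \<bullet> (x1 - x2)"
      using key[OF balls[OF y(2)] balls[OF y(1)]] X_eq[OF x(1) balls[OF y(1)] n(1)]
        X_eq[OF x(2) balls[OF y(2)] n(2)] by simp
  qed (use s' base in auto)
  then show ?thesis using s'(1) unfolding B_def[abs_def] by blast
qed

text \<open>Continuation in \<open>l\<close> from \<open>norm A + 1\<close> down to \<open>0\<close>. Each step lowers \<open>l\<close> by at most \<open>\<kappa> / 2\<close>, which leaves
  a positive modulus; the modulus \<open>\<kappa>\<close> is then restored at the price of a smaller radius. The
  number of steps is thus fixed in advance.\<close>

lemma strong_solvability_of_positive:
  fixes C :: "'a::{real_inner, complete_space} set" and A :: "'a \<Rightarrow>\<^sub>L 'a"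
  assumes C: "closed C" "convex C" and lsc: "weakly_lsc (\<lambda>w. blinfun_apply A w \<bullet> w)"
    and \<kappa>: "0 < \<kappa>" and \<eta>: "0 < \<eta>" and nb: "nb \<in> normal_cone C xb"
    and pos: "positive_on_critical_cones C A \<kappa> \<eta> xb nb"
  shows "\<exists>s>0. strong_solvability C (blinfun_apply A) \<kappa> s xb (nb + blinfun_apply A xb)"
proof -
  define L where "L = norm A + 1"
  have L: "0 < L" by (simp add: L_def add_nonneg_pos)
  obtain M :: nat where "2 * L / \<kappa> < M" using reals_Archimedean2 by blast
  moreover have "0 < 2 * L / \<kappa>" using L \<kappa> by simp
  ultimately have "0 < real M" by linarith
  then have M: "0 < M" "L / M \<le> \<kappa> / 2" using L \<kappa> \<open>2 * L / \<kappa> < M\<close> by (auto simp: field_simps)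
  define l where "l k = L - real k * (L / M)" for k
  have improve: "\<exists>s>0. strong_solvability C (\<lambda>x. blinfun_apply A x + l k *\<^sub>R x) \<kappa> s xb
      (nb + (blinfun_apply A xb + l k *\<^sub>R xb))"
    if "k \<le> M" "0 < \<kappa>1" "strong_solvability C (\<lambda>x. blinfun_apply A x + l k *\<^sub>R x) \<kappa>1 s xb
      (nb + (blinfun_apply A xb + l k *\<^sub>R xb))" for k \<kappa>1 s
  proof (rule strong_solvability_improve[OF C(2) lsc \<kappa> \<eta> pos _ that(2,3) refl])
    show "0 \<le> l k" using that(1) M(1) L by (simp add: l_def field_simps mult_left_mono)
  qed
  have "\<exists>s>0. strong_solvability C (\<lambda>x. blinfun_apply A x + l k *\<^sub>R x) \<kappa> s xb
      (nb + (blinfun_apply A xb + l k *\<^sub>R xb))" if "k \<le> M" for k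
    using that
  proof (induction k)
    case 0
    have "strong_solvability C (\<lambda>x. L *\<^sub>R x + blinfun_apply A x) (L - norm A) 1 xb
        ((nb + L *\<^sub>R xb) + blinfun_apply A xb)"
    proof (rule strong_solvability_perturb)
      show "strong_solvability C ((*\<^sub>R) L) L 1 xb (nb + L *\<^sub>R xb)"
        by (rule strong_solvability_scaled_identity[OF C nb L]) simp
      show "norm A < L" by (simp add: L_def)
      show "norm (blinfun_apply A x - blinfun_apply A x') \<le> norm A * norm (x - x')" for x x'
        using norm_blinfun[of A "x - x'"] by (simp add: blinfun.diff_right)
    qed simp
    then have "strong_solvability C (\<lambda>x. blinfun_apply A x + l 0 *\<^sub>R x) (L - norm A) 1 xb
        (nb + (blinfun_apply A xb + l 0 *\<^sub>R xb))"
      by (simp add: l_def add_ac)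
    then show ?case by (intro improve[of 0 "L - norm A"]) (auto simp: L_def)
  next
    case (Suc k)
    then obtain s where s: "strong_solvability C (\<lambda>x. blinfun_apply A x + l k *\<^sub>R x) \<kappa> s xb
      (nb + (blinfun_apply A xb + l k *\<^sub>R xb))" by auto
    have l_Suc: "l (Suc k) = l k - L / M" by (simp add: l_def algebra_simps add_divide_distrib)
    have "strong_solvability C (\<lambda>x. (blinfun_apply A x + l k *\<^sub>R x) + - (L / M) *\<^sub>R x) (\<kappa> - L / M) s xb
      ((nb + (blinfun_apply A xb + l k *\<^sub>R xb)) + - (L / M) *\<^sub>R xb)"
    proof (rule strong_solvability_perturb[OF s])
      show "0 \<le> L / M" using L M by simp
      show "L / M < \<kappa>" using M(2) \<kappa> by linarith
      show "norm (- (L / M) *\<^sub>R x - - (L / M) *\<^sub>R x') \<le> L / M * norm (x - x')" for x x'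
      proof -
        have "- (L / M) *\<^sub>R x - - (L / M) *\<^sub>R x' = - (L / M) *\<^sub>R (x - x')" by (simp only: scaleR_diff_right)
        then show ?thesis using L by simp
      qed
    qed
    then have "strong_solvability C (\<lambda>x. blinfun_apply A x + l (Suc k) *\<^sub>R x) (\<kappa> - L / M) s xb
        (nb + (blinfun_apply A xb + l (Suc k) *\<^sub>R xb))"
      unfolding l_Suc by (simp add: algebra_simps)
    moreover have "0 < \<kappa> - L / M" using M(2) \<kappa> by linarith
    ultimately show ?case using Suc.prems by (intro improve[of "Suc k" "\<kappa> - L / M"])
  qed
  from this[of M] show ?thesis using M by (simp add: l_def)
qed

section \<open>Uniform positivity from the Legendre property\<close>

text \<open>If no \<open>\<kappa>\<close> works, there are unit critical vectors \<open>w k\<close> at points converging to \<open>(xb, nb)\<close> with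
  \<open>limsup Q (w k) \<le> 0\<close>. A weak cluster point \<open>z\<close> satisfies \<open>Q z \<le> 0\<close> by weak lower semicontinuity, hence \<open>z = 0\<close>
  by assumption. Then \<open>Q (w k)\<close> tends to \<open>Q 0\<close> along the subsequence, and the Legendre property
  makes unit vectors converge to \<open>0\<close> in norm.\<close>

lemma uniformly_positive_on_critical_cones:
  fixes C :: "'a::{real_inner, complete_space} set" and A :: "'a \<Rightarrow>\<^sub>L 'a"
  assumes Leg: "Legendre_form (\<lambda>w. blinfun_apply A w \<bullet> w)"
    and H: "\<forall>w\<in>H_weak C xb nb. w \<noteq> 0 \<longrightarrow> 0 < blinfun_apply A w \<bullet> w"
  shows "\<exists>\<kappa>>0. positive_on_critical_cones C A \<kappa> \<kappa> xb nb"
proof (rule ccontr)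
  define Q where "Q w = blinfun_apply A w \<bullet> w" for w
  assume neg: "\<not> ?thesis"
  have "\<exists>x n w. n \<in> normal_cone C x \<and> norm (x - xb) < 1 / Suc k \<and> norm (n - nb) < 1 / Suc k \<and>
      w \<in> critical_cone C x n \<and> norm w = 1 \<and> Q w < 1 / Suc k" for k
  proof -
    have "0 < 1 / real (Suc k)" by simp
    then obtain x n w where *: "n \<in> normal_cone C x" "norm (x - xb) < 1 / Suc k" "norm (n - nb) < 1 / Suc k"
      "w \<in> critical_cone C x n" "Q w < 1 / Suc k * (norm w)\<^sup>2"
      using neg unfolding positive_on_critical_cones_def Q_def not_le[symmetric] by blast
    then have "w \<noteq> 0" by (auto simp: Q_def)
    define w' where "w' = inverse (norm w) *\<^sub>R w"
    have "Q w' = Q w / (norm w)\<^sup>2"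
      by (simp add: Q_def w'_def blinfun.scaleR_right power2_eq_square divide_inverse)
    then have "Q w' < 1 / Suc k"
      using *(5) \<open>w \<noteq> 0\<close> by (simp add: pos_divide_less_eq del: of_nat_Suc)
    moreover have "w' \<in> critical_cone C x n"
      unfolding w'_def using *(4) \<open>w \<noteq> 0\<close> by (intro critical_cone_scale) auto
    moreover have "norm w' = 1" using \<open>w \<noteq> 0\<close> by (simp add: w'_def)
    ultimately show ?thesis using * by blast
  qed
  then obtain x n w where n: "\<And>k. n k \<in> normal_cone C (x k)" and x_lim: "\<And>k. norm (x k - xb) < 1 / Suc k"
    and n_lim: "\<And>k. norm (n k - nb) < 1 / Suc k" and w: "\<And>k. w k \<in> critical_cone C (x k) (n k)"
    and w1: "\<And>k. norm (w k) = 1" and Qw: "\<And>k. Q (w k) < 1 / Suc k"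
    by metis
  have w1': "norm (w k) \<le> 1" for k using w1 by simp
  obtain r z where r: "strict_mono r" and z: "weakly_tendsto (w \<circ> r) z"
    using bounded_weakly_convergent_subseq[where x = w, OF w1'] by metis
  have inv: "(\<lambda>k. 1 / real (Suc k)) \<longlonglongrightarrow> 0"
    using LIMSEQ_inverse_real_of_nat by (simp add: inverse_eq_divide)
  have invr: "(\<lambda>k. 1 / real (Suc (r k))) \<longlonglongrightarrow> 0"
    using LIMSEQ_subseq_LIMSEQ[OF inv r] by (simp add: o_def)
  have "(\<lambda>k. x k - xb) \<longlonglongrightarrow> 0" "(\<lambda>k. n k - nb) \<longlonglongrightarrow> 0"
    using x_lim n_lim by (auto intro!: Lim_null_comparison[OF _ inv] always_eventually less_imp_le simp del: of_nat_Suc)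
  then have "x \<longlonglongrightarrow> xb" "n \<longlonglongrightarrow> nb" by (auto simp: LIM_zero_iff)
  then have "(x \<circ> r) \<longlonglongrightarrow> xb" "(n \<circ> r) \<longlonglongrightarrow> nb" using LIMSEQ_subseq_LIMSEQ[OF _ r] by auto
  then have zH: "z \<in> H_weak C xb nb"
    unfolding H_weak_def using n w z by (intro CollectI exI[of _ "x \<circ> r"] exI[of _ "n \<circ> r"] exI[of _ "w \<circ> r"]) auto
  have lsc: "weakly_lsc Q" using Leg unfolding Legendre_form_def Q_def[abs_def] by blast
  have "Q z \<le> 0"
    using Qw by (intro weakly_lsc_limit_le[OF lsc z invr]) (simp add: less_imp_le del: of_nat_Suc)
  then have "z = 0" using bspec[OF H zH] by (auto simp: Q_def)
  have "(\<lambda>k. Q ((w \<circ> r) k)) \<longlonglongrightarrow> Q z"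
  proof (rule LIMSEQ_I)
    fix e :: real assume "0 < e"
    have "\<forall>\<^sub>F k in sequentially. Q ((w \<circ> r) k) < e"
      using order_tendstoD(2)[OF invr \<open>0 < e\<close>]
      by eventually_elim (use Qw in \<open>force intro: less_trans simp del: of_nat_Suc\<close>)
    moreover have "\<forall>\<^sub>F k in sequentially. - e < Q ((w \<circ> r) k)"
    proof -
      have "closedin weak_topology {v. Q v \<le> - e}" using lsc by (simp add: weakly_lsc_def)
      moreover have "z \<notin> {v. Q v \<le> - e}" using \<open>z = 0\<close> \<open>0 < e\<close> by (simp add: Q_def)
      ultimately have "openin weak_topology (topspace weak_topology - {v. Q v \<le> - e})"
        "z \<in> topspace weak_topology - {v. Q v \<le> - e}"
        using z by (auto simp: limitin_def)
      then have "\<forall>\<^sub>F k in sequentially. (w \<circ> r) k \<in> topspace weak_topology - {v. Q v \<le> - e}"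
        using z unfolding limitin_def by blast
      then show ?thesis by eventually_elim auto
    qed
    ultimately have "\<forall>\<^sub>F k in sequentially. norm (Q ((w \<circ> r) k) - Q z) < e"
      by eventually_elim (use \<open>z = 0\<close> in \<open>simp add: Q_def abs_less_iff\<close>)
    then show "\<exists>N. \<forall>k\<ge>N. norm (Q ((w \<circ> r) k) - Q z) < e" by (simp add: eventually_sequentially)
  qed
  then have "(w \<circ> r) \<longlonglongrightarrow> z" using Leg z unfolding Legendre_form_def Q_def by blast
  then have "(\<lambda>k. norm ((w \<circ> r) k)) \<longlonglongrightarrow> norm z" by (rule tendsto_norm)
  then have "(\<lambda>k. 1 :: real) \<longlonglongrightarrow> 0" using w1 \<open>z = 0\<close> by simp
  then show False using LIMSEQ_unique[OF tendsto_const, of "1::real" 0] by simp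
qed

section \<open>From critical cones to full stability\<close>

lemma strong_solvability_shrink:
  assumes ss: "strong_solvability C B \<kappa> s xb yb" and \<kappa>: "0 < \<kappa>" and s': "0 < s'" "s' \<le> s"
  shows "strong_solvability C B \<kappa> s' xb yb"
proof -
  have s: "0 < s" and base: "yb - B xb \<in> normal_cone C xb"
    and ex: "\<And>y. y \<in> ball yb (\<kappa> * s) \<Longrightarrow> \<exists>x\<in>ball xb s. y - B x \<in> normal_cone C x"
    using ss unfolding strong_solvability_def by blast+
  have balls: "ball yb (\<kappa> * s') \<subseteq> ball yb (\<kappa> * s)" "ball xb s' \<subseteq> ball xb s"
    using s' \<kappa> by (auto intro!: subset_ball)
  have "\<exists>x\<in>ball xb s'. y - B x \<in> normal_cone C x" if y: "y \<in> ball yb (\<kappa> * s')" for y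
  proof -
    obtain x where x: "x \<in> ball xb s" "y - B x \<in> normal_cone C x" using ex y balls(1) by blast
    have "\<kappa> * norm (x - xb) \<le> norm (y - yb)"
      using x y balls(1) s \<kappa> base by (intro strong_solvability_lipschitz[OF ss]) auto
    also have "\<dots> < \<kappa> * s'" using y by (simp add: dist_norm norm_minus_commute)
    finally have "x \<in> ball xb s'" using \<kappa> by (simp add: dist_norm norm_minus_commute)
    then show ?thesis using x(2) by blast
  qed
  then show ?thesis
    unfolding strong_solvability_def using s'(1) base strong_solvability_mono[OF ss] balls by blast
qed

lemma solution_map_iff: "x \<in> solution_map f C v p \<longleftrightarrow> v - f x p \<in> normal_cone C x"
proof
  assume "x \<in> solution_map f C v p"
  then show "v - f x p \<in> normal_cone C x" by (auto simp: solution_map_def)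
next
  assume "v - f x p \<in> normal_cone C x"
  then have "f x p + (v - f x p) \<in> (\<lambda>n. f x p + n) ` normal_cone C x" by (rule imageI)
  then show "x \<in> solution_map f C v p" by (simp add: solution_map_def)
qed

lemma nabla_x_has_derivative:
  assumes "(\<lambda>y. f y p) differentiable (at x)"
  shows "((\<lambda>y. f y p) has_derivative blinfun_apply (nabla_x f x p)) (at x)"
proof -
  have D: "((\<lambda>y. f y p) has_derivative frechet_derivative (\<lambda>y. f y p) (at x)) (at x)"
    using assms by (simp add: frechet_derivative_works)
  then have "bounded_linear (frechet_derivative (\<lambda>y. f y p) (at x))" by (rule has_derivative_bounded_linear)
  then show ?thesis using D by (simp add: nabla_x_def bounded_linear_Blinfun_apply)
qed

lemma assumption_A4_differentiable:
  assumes "assumption_A4 f xb pb"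
  obtains U P where "open U" "xb \<in> U" "open P" "pb \<in> P"
    "\<forall>x\<in>U. \<forall>p\<in>P. (\<lambda>y. f y p) differentiable (at x)"
proof -
  obtain U P where U: "open U" "xb \<in> U" "open P" "pb \<in> P"
    and "\<forall>x\<in>U. (\<forall>p\<in>P. (\<lambda>y. f y p) differentiable (at x)) \<and>
      (\<forall>\<epsilon>>0. \<exists>\<delta>>0. \<forall>p\<in>P. \<forall>h. norm h < \<delta> \<longrightarrow>
        norm (f (x + h) p - f x p - blinfun_apply (nabla_x f x p) h) \<le> \<epsilon> * norm h)"
    using assms unfolding assumption_A4_def by (elim exE conjE) (rule that)
  then have "\<forall>x\<in>U. \<forall>p\<in>P. (\<lambda>y. f y p) differentiable (at x)" by simp
  with U show thesis by (rule that)
qed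

text \<open>Continuity of the derivative jointly in \<open>(x, p)\<close> upgrades differentiability to strict
  differentiability, uniformly in the parameter, by the mean value inequality.\<close>

lemma assumption_A4_near_linear:
  fixes f :: "'a::real_normed_vector \<Rightarrow> 'p::metric_space \<Rightarrow> 'a"
  assumes A4: "assumption_A4 f xb pb" and \<mu>: "0 < \<mu>"
  shows "\<exists>r>0. \<forall>p\<in>ball pb r. \<forall>x\<in>ball xb r. \<forall>x'\<in>ball xb r.
    norm ((f x p - blinfun_apply (nabla_x f xb pb) x) - (f x' p - blinfun_apply (nabla_x f xb pb) x'))
      \<le> \<mu> * norm (x - x')"
proof -
  define A where "A = nabla_x f xb pb"
  obtain U P where U: "open U" "xb \<in> U" and P: "open P" "pb \<in> P"
    and diff: "\<forall>x\<in>U. \<forall>p\<in>P. (\<lambda>y. f y p) differentiable (at x)"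
    using assumption_A4_differentiable[OF A4] .
  have cont: "isCont (\<lambda>(x, p). nabla_x f x p) (xb, pb)"
    using A4 by (simp add: assumption_A4_def)
  obtain d where d: "0 < d" "\<And>z. dist z (xb, pb) < d \<Longrightarrow> dist ((\<lambda>(x, p). nabla_x f x p) z) A < \<mu>"
    using cont[unfolded continuous_at_eps_delta, rule_format, OF \<mu>] by (auto simp: A_def)
  obtain e1 where e1: "0 < e1" "ball xb e1 \<subseteq> U" using U open_contains_ball by blast
  obtain e2 where e2: "0 < e2" "ball pb e2 \<subseteq> P" using P open_contains_ball by blast
  define r where "r = min (d / 2) (min e1 e2)"
  have r: "0 < r" "r \<le> d / 2" "r \<le> e1" "r \<le> e2" using d e1 e2 by (auto simp: r_def)
  have "norm ((f x p - blinfun_apply A x) - (f x' p - blinfun_apply A x')) \<le> \<mu> * norm (x - x')"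
    if p: "p \<in> ball pb r" and x: "x \<in> ball xb r" "x' \<in> ball xb r" for p x x'
  proof (rule differentiable_bound[where S = "ball xb r" and f' = "\<lambda>y. blinfun_apply (nabla_x f y p - A)"])
    fix y assume y: "y \<in> ball xb r"
    have "ball xb r \<subseteq> U" "ball pb r \<subseteq> P"
      using order_trans[OF subset_ball[OF r(3)] e1(2)] order_trans[OF subset_ball[OF r(4)] e2(2)] .
    then have yp: "y \<in> U" "p \<in> P" using subsetD y p by metis+
    have "((\<lambda>y. f y p) has_derivative blinfun_apply (nabla_x f y p)) (at y within ball xb r)"
      by (rule has_derivative_at_withinI, rule nabla_x_has_derivative, rule diff[rule_format, OF yp])
    moreover have "((blinfun_apply A) has_derivative blinfun_apply A) (at y within ball xb r)"
      by (rule bounded_linear_imp_has_derivative[OF blinfun.bounded_linear_right])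
    ultimately have "((\<lambda>y. f y p - blinfun_apply A y) has_derivative
        (\<lambda>h. blinfun_apply (nabla_x f y p) h - blinfun_apply A h)) (at y within ball xb r)"
      by (rule has_derivative_diff)
    then show "((\<lambda>y. f y p - blinfun_apply A y) has_derivative blinfun_apply (nabla_x f y p - A))
        (at y within ball xb r)"
      by (simp add: blinfun.diff_left[abs_def])
    have "dist (y, p) (xb, pb) \<le> dist y xb + dist p pb"
      by (simp add: dist_Pair_Pair sqrt_sum_squares_le_sum)
    also have "\<dots> < d" using y p r by (simp add: dist_commute)
    finally have "norm (nabla_x f y p - A) < \<mu>" using d(2) by (fastforce simp: dist_norm)
    then show "onorm (blinfun_apply (nabla_x f y p - A)) \<le> \<mu>" by (simp add: norm_blinfun.rep_eq)
  qed (use x in auto)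
  then show ?thesis using r(1) unfolding A_def by blast
qed

text \<open>Expanding the square, the claim reduces to \<open>0 \<le> (d - K * norm x)\<^sup>2\<close>.\<close>

lemma full_stability_inequality:
  fixes v x :: "'a::real_inner"
  assumes K: "0 < K" and d: "0 \<le> d" and mono: "K * (norm x)\<^sup>2 \<le> v \<bullet> x + d * norm x"
  shows "norm (v - K *\<^sub>R x) \<le> norm v + d"
proof -
  have "(norm (v - K *\<^sub>R x))\<^sup>2 = (norm v)\<^sup>2 - 2 * K * (v \<bullet> x) + K\<^sup>2 * (norm x)\<^sup>2"
    by (simp add: power2_norm_eq_inner power2_eq_square[of K] inner_commute algebra_simps)
  also have "\<dots> \<le> (norm v)\<^sup>2 - 2 * K * (K * (norm x)\<^sup>2 - d * norm x) + K\<^sup>2 * (norm x)\<^sup>2"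
    using mono K mult_left_mono[of "K * (norm x)\<^sup>2 - d * norm x" "v \<bullet> x" "2 * K"] by simp
  also have "\<dots> = (norm v)\<^sup>2 + d\<^sup>2 - (d - K * norm x)\<^sup>2"
    by (simp add: power2_eq_square algebra_simps)
  also have "\<dots> \<le> (norm v + d)\<^sup>2"
  proof -
    have "(norm v + d)\<^sup>2 = (norm v)\<^sup>2 + d\<^sup>2 + 2 * (norm v * d)" by (simp add: power2_eq_square algebra_simps)
    moreover have "0 \<le> norm v * d" using d by simp
    ultimately show ?thesis using zero_le_power2[of "d - K * norm x"] by linarith
  qed
  finally show ?thesis using d by (meson add_nonneg_nonneg norm_ge_zero power2_le_imp_le)
qed

text \<open>For each fixed \<open>p\<close> the map \<open>\<lambda>x. f x p\<close> is the derivative at the reference point plus a map of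
  Lipschitz constant \<open>\<kappa> / 2\<close>, on a ball that
  does not depend on \<open>p\<close>. Two solutions with different parameters are compared by
  regarding the second one as a solution for the first parameter, with right-hand side shifted by
  \<open>f x2 p1 - f x2 p2\<close>.\<close>

lemma fully_stable_of_strong_solvability:
  fixes C :: "'a::{real_inner, complete_space} set" and f :: "'a \<Rightarrow> 'p::metric_space \<Rightarrow> 'a"
  assumes A1: "assumption_A1 f xbar pbar" and A4: "assumption_A4 f xbar pbar"
    and \<kappa>: "0 < \<kappa>" and ss: "strong_solvability C (blinfun_apply (nabla_x f xbar pbar)) \<kappa> s xbar
      (vbar - f xbar pbar + blinfun_apply (nabla_x f xbar pbar) xbar)"
  shows "fully_stable (solution_map f C) vbar pbar xbar"
proof -
  define A where "A = nabla_x f xbar pbar"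
  define K where "K = \<kappa> / 2"
  have K: "0 < K" "K < \<kappa>" using \<kappa> by (auto simp: K_def)
  obtain L U1 P1 where L: "0 < L" and U1: "open U1" "xbar \<in> U1" and P1: "open P1" "pbar \<in> P1"
    and "\<forall>x1\<in>U1. \<forall>x2\<in>U1. \<forall>p1\<in>P1. \<forall>p2\<in>P1.
          norm (f x1 p1 - f x2 p2) \<le> L * (norm (x1 - x2) + dist p1 p2)"
    using A1 unfolding assumption_A1_def by (elim exE conjE) (rule that)
  then have lip: "norm (f x1 p1 - f x2 p2) \<le> L * (norm (x1 - x2) + dist p1 p2)"
    if "x1 \<in> U1" "x2 \<in> U1" "p1 \<in> P1" "p2 \<in> P1" for x1 x2 p1 p2
    using that by blast
  obtain r where r: "0 < r" and near: "\<And>p x x'. p \<in> ball pbar r \<Longrightarrow> x \<in> ball xbar r \<Longrightarrow> x' \<in> ball xbar r \<Longrightarrow>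
      norm ((f x p - blinfun_apply A x) - (f x' p - blinfun_apply A x')) \<le> K * norm (x - x')"
    using assumption_A4_near_linear[OF A4 K(1)] unfolding A_def by blast
  obtain e where e: "0 < e" "ball xbar e \<subseteq> U1" using U1 open_contains_ball by blast
  define t where "t = min s (min r e)"
  have t: "0 < t" "t \<le> s" "t \<le> r" "t \<le> e" using ss r e by (auto simp: t_def strong_solvability_def)
  have tU: "ball xbar t \<subseteq> U1" "ball xbar t \<subseteq> ball xbar r"
    using order_trans[OF subset_ball[OF t(4)] e(2)] subset_ball[OF t(3)] .
  \<comment> \<open>A right-hand side is within \<open>\<rho>\<close> of \<open>vbar\<close>, recentring at another parameter costs \<open>\<rho>\<close>, and the
    shift that compares two parameters costs \<open>2 * \<rho>\<close>: in total \<open>4 * \<rho> = K * t\<close>.\<close>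
  define \<rho> where "\<rho> = K * t / 4"
  have \<rho>: "0 < \<rho>" "4 * \<rho> = K * t" using K t by (auto simp: \<rho>_def)
  define V where "V = ball vbar \<rho>"
  define P where "P = P1 \<inter> (ball pbar r \<inter> ball pbar (\<rho> / L))"
  define nb where "nb = vbar - f xbar pbar"
  have ssp: "strong_solvability C (\<lambda>x. f x p) K t xbar (nb + f xbar p)" if "p \<in> P" for p
  proof -
    have "strong_solvability C (\<lambda>x. blinfun_apply A x + (f x p - blinfun_apply A x)) (\<kappa> - K) t xbar
        ((nb + blinfun_apply A xbar) + (f xbar p - blinfun_apply A xbar))"
    proof (rule strong_solvability_perturb)
      show "strong_solvability C (blinfun_apply A) \<kappa> t xbar (nb + blinfun_apply A xbar)"
        using strong_solvability_shrink[OF ss \<kappa> t(1,2)] by (simp add: A_def nb_def)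
      show "norm ((f x p - blinfun_apply A x) - (f x' p - blinfun_apply A x')) \<le> K * norm (x - x')"
        if "x \<in> ball xbar t" "x' \<in> ball xbar t" for x x'
        using \<open>p \<in> P\<close> that tU(2) by (intro near) (auto simp: P_def simp del: mem_ball)
    qed (use K in auto)
    moreover have "\<kappa> - K = K" by (simp add: K_def)
    ultimately show ?thesis by simp
  qed
  have L\<rho>: "L * dist pbar p < \<rho>" if "p \<in> P" for p
    using that L by (simp add: P_def pos_less_divide_eq mult.commute)
  have center: "norm (v - (nb + f xbar p)) < 2 * \<rho>" if "v \<in> V" "p \<in> P" for v p
  proof -
    have "v - (nb + f xbar p) = (v - vbar) + (f xbar pbar - f xbar p)" by (simp add: nb_def)
    then have "norm (v - (nb + f xbar p)) \<le> norm (v - vbar) + norm (f xbar pbar - f xbar p)"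
      by (metis norm_triangle_ineq)
    moreover have "norm (f xbar pbar - f xbar p) \<le> L * (norm (xbar - xbar) + dist pbar p)"
      using that U1 P1 by (intro lip) (auto simp: P_def)
    moreover have "norm (v - vbar) < \<rho>" using that by (simp add: V_def dist_norm norm_minus_commute)
    ultimately show ?thesis using L\<rho>[OF that(2)] by simp
  qed
  have mono: "K * (norm (x1 - x2))\<^sup>2 \<le> (v1 - v2) \<bullet> (x1 - x2) + L * dist p1 p2 * norm (x1 - x2)"
    if v: "v1 \<in> V" "v2 \<in> V" and p: "p1 \<in> P" "p2 \<in> P" and x: "x1 \<in> ball xbar t" "x2 \<in> ball xbar t"
      and sol: "x1 \<in> solution_map f C v1 p1" "x2 \<in> solution_map f C v2 p2" for v1 v2 p1 p2 x1 x2
  proof -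
    define w where "w = f x2 p1 - f x2 p2"
    have w: "norm w \<le> L * dist p1 p2"
      using lip[of x2 x2 p1 p2] subsetD[OF tU(1) x(2)] p by (simp add: w_def P_def)
    have "L * dist p1 p2 \<le> L * (dist pbar p1 + dist pbar p2)"
      using L dist_triangle3[of p1 p2 pbar] by (intro mult_left_mono) auto
    then have w2: "norm w < 2 * \<rho>" using w L\<rho>[OF p(1)] L\<rho>[OF p(2)] by (simp add: algebra_simps)
    have "K * (norm (x1 - x2))\<^sup>2 \<le> (v1 - (v2 + w)) \<bullet> (x1 - x2)"
    proof (rule strong_solvability_mono[OF ssp[OF p(1)] x])
      show "v1 \<in> ball (nb + f xbar p1) (K * t)"
        using center[OF v(1) p(1)] \<rho> by (simp add: dist_norm norm_minus_commute)
      have "norm ((v2 + w) - (nb + f xbar p1)) \<le> norm (v2 - (nb + f xbar p1)) + norm w"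
        using norm_triangle_ineq[of "v2 - (nb + f xbar p1)" w] by (simp add: algebra_simps)
      then show "v2 + w \<in> ball (nb + f xbar p1) (K * t)"
        using center[OF v(2) p(1)] w2 \<rho> by (simp add: dist_norm norm_minus_commute)
      show "v1 - f x1 p1 \<in> normal_cone C x1" using sol by (simp add: solution_map_iff)
      show "v2 + w - f x2 p1 \<in> normal_cone C x2" using sol by (simp add: solution_map_iff w_def)
    qed
    also have "\<dots> = (v1 - v2) \<bullet> (x1 - x2) - w \<bullet> (x1 - x2)" by (simp add: algebra_simps)
    also have "\<dots> \<le> (v1 - v2) \<bullet> (x1 - x2) + L * dist p1 p2 * norm (x1 - x2)"
      using Cauchy_Schwarz_ineq2[of w "x1 - x2"] mult_right_mono[OF w norm_ge_zero[of "x1 - x2"]] by linarith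
    finally show ?thesis .
  qed
  have ex: "\<exists>x. x \<in> ball xbar t \<and> x \<in> solution_map f C v p" if "v \<in> V" "p \<in> P" for v p
  proof -
    have "v \<in> ball (nb + f xbar p) (K * t)"
      using center[OF that] \<rho> by (simp add: dist_norm norm_minus_commute)
    then show ?thesis using ssp[OF that(2)] unfolding strong_solvability_def solution_map_iff by blast
  qed
  then obtain \<theta> where \<theta>: "\<And>v p. v \<in> V \<Longrightarrow> p \<in> P \<Longrightarrow> \<theta> v p \<in> ball xbar t \<and> \<theta> v p \<in> solution_map f C v p"
    by metis
  have uniq: "x = \<theta> v p" if "v \<in> V" "p \<in> P" "x \<in> ball xbar t" "x \<in> solution_map f C v p" for v p x
  proof -
    have "K * (norm (x - \<theta> v p))\<^sup>2 \<le> (v - v) \<bullet> (x - \<theta> v p) + L * dist p p * norm (x - \<theta> v p)"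
      using that \<theta> by (intro mono) auto
    then show ?thesis using K by (simp add: mult_le_0_iff)
  qed
  have bound: "norm ((v1 - v2) - (2 * (K / 2)) *\<^sub>R (\<theta> v1 p1 - \<theta> v2 p2)) \<le> norm (v1 - v2) + L * dist p1 p2"
    if "v1 \<in> V" "v2 \<in> V" "p1 \<in> P" "p2 \<in> P" for v1 v2 p1 p2
    using full_stability_inequality[OF K(1) _ mono[of v1 v2 p1 p2 "\<theta> v1 p1" "\<theta> v2 p2"]] \<theta> that L by simp
  have "\<exists>\<kappa>>0. \<exists>l>0. \<forall>v1\<in>V. \<forall>v2\<in>V. \<forall>p1\<in>P. \<forall>p2\<in>P.
      norm ((v1 - v2) - (2 * \<kappa>) *\<^sub>R (\<theta> v1 p1 - \<theta> v2 p2)) \<le> norm (v1 - v2) + l * dist p1 p2"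
    by (rule exI[of _ "K / 2"], intro conjI, simp add: K, rule exI[of _ L], intro conjI L ballI bound)
  moreover have "{(v, p, x). v \<in> V \<and> p \<in> P \<and> x = \<theta> v p}
      = {(v, p, x). x \<in> solution_map f C v p} \<inter> (V \<times> P \<times> ball xbar t)"
    using \<theta> uniq by blast
  moreover have "open V" "vbar \<in> V" "open P" "pbar \<in> P" "open (ball xbar t)" "xbar \<in> ball xbar t"
    using \<rho> r L P1 t by (auto simp: V_def P_def intro!: open_Int)
  ultimately show ?thesis
    unfolding fully_stable_def
    by - (rule exI[of _ V], rule exI[of _ P], rule exI[of _ "ball xbar t"], rule exI[of _ \<theta>],
      intro conjI; assumption)
qed

section \<open>From full stability to critical cones\<close>

text \<open>The condition \<open>n \<bullet> w = 0\<close> makes \<open>n\<close> a normal at \<open>x + t *\<^sub>R w\<close> as well, so strong monotonicity compares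
  two points with the same normal and becomes a condition on the increments of \<open>F\<close> alone.\<close>

lemma derivative_bound_of_strong_monotonicity:
  fixes C :: "'a::real_inner set" and F :: "'a \<Rightarrow> 'a"
  assumes C: "convex C" and n: "n \<in> normal_cone C x" and w: "w \<in> radial_cone C x" "n \<bullet> w = 0"
    and D: "(F has_derivative D) (at x)"
    and U: "open U" "x \<in> U" and V: "open V" "n + F x \<in> V"
    and mono: "\<And>x1 x2 n1 n2. n1 \<in> normal_cone C x1 \<Longrightarrow> n2 \<in> normal_cone C x2 \<Longrightarrow> x1 \<in> U \<Longrightarrow> x2 \<in> U \<Longrightarrow>
      n1 + F x1 \<in> V \<Longrightarrow> n2 + F x2 \<in> V \<Longrightarrow>
      \<kappa> * (norm (x1 - x2))\<^sup>2 \<le> ((n1 + F x1) - (n2 + F x2)) \<bullet> (x1 - x2)"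
  shows "\<kappa> * (norm w)\<^sup>2 \<le> D w \<bullet> w"
proof -
  have xC: "x \<in> C" by (rule normal_coneD(1)[OF n])
  obtain t0 where t0: "0 < t0" "x + t0 *\<^sub>R w \<in> C" using w(1) by (auto simp: radial_cone_iff)
  define y where "y t = x + t *\<^sub>R w" for t :: real
  have nt: "n \<in> normal_cone C (y t)" if "0 \<le> t" "t \<le> t0" for t
    using segment_in_convex[OF C xC t0(2) that] normal_coneD(2)[OF n] w(2)
    by (simp add: normal_cone_def y_def inner_diff_right inner_add_right)
  have y_lim: "(y \<longlongrightarrow> x) (at_right 0)"
    unfolding y_def by (rule tendsto_eq_intros | simp)+
  have "isCont F x" by (rule has_derivative_continuous[OF D])
  then have "((\<lambda>t. n + F (y t)) \<longlongrightarrow> n + F x) (at_right 0)"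
    by (intro tendsto_intros isCont_tendsto_compose[OF _ y_lim])
  then have evV: "\<forall>\<^sub>F t in at_right 0. n + F (y t) \<in> V" by (rule topological_tendstoD[OF _ V])
  have evU: "\<forall>\<^sub>F t in at_right 0. y t \<in> U" by (rule topological_tendstoD[OF y_lim U])
  have ev0: "\<forall>\<^sub>F t in at_right 0. 0 < t \<and> t \<le> t0"
    using t0(1) unfolding eventually_at_right_field by (meson less_imp_le)
  have "\<forall>\<^sub>F t in at_right 0. \<kappa> * (norm w)\<^sup>2 \<le> (F (y (0 + t)) \<bullet> w - F (y 0) \<bullet> w) / t"
    using evV evU ev0
  proof eventually_elim
    case (elim t)
    have "\<kappa> * (norm (y t - x))\<^sup>2 \<le> ((n + F (y t)) - (n + F x)) \<bullet> (y t - x)"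
      by (rule mono[OF nt n]) (use elim U V in auto)
    also have "y t - x = t *\<^sub>R w" by (simp add: y_def)
    finally have "t * (t * (\<kappa> * (norm w)\<^sup>2)) \<le> t * (F (y t) \<bullet> w - F x \<bullet> w)"
      using elim by (simp add: power_mult_distrib power2_eq_square inner_diff_left algebra_simps)
    then have "t * (\<kappa> * (norm w)\<^sup>2) \<le> F (y t) \<bullet> w - F x \<bullet> w"
      using elim by (meson mult_le_cancel_left_pos)
    then show ?case using elim by (simp add: y_def pos_le_divide_eq mult.commute)
  qed
  moreover have "((\<lambda>t. F (y t) \<bullet> w) has_field_derivative (D w \<bullet> w)) (at 0)"
  proof -
    have "(y has_derivative (\<lambda>h. h *\<^sub>R w)) (at 0)"
      unfolding y_def by (auto intro!: derivative_eq_intros)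
    moreover have "(F has_derivative D) (at (y 0))" using D by (simp add: y_def)
    ultimately have "((\<lambda>t. F (y t)) has_derivative (\<lambda>h. D (h *\<^sub>R w))) (at 0)"
      by (rule has_derivative_compose)
    then have "((\<lambda>t. F (y t) \<bullet> w) has_derivative (\<lambda>h. D (h *\<^sub>R w) \<bullet> w)) (at 0)"
      by (rule has_derivative_inner_left)
    moreover have "D (h *\<^sub>R w) \<bullet> w = (D w \<bullet> w) * h" for h
      using linear_scale[OF has_derivative_linear[OF D]] by simp
    ultimately show ?thesis by (simp add: has_field_derivative_def)
  qed
  then have "((\<lambda>t. (F (y (0 + t)) \<bullet> w - F (y 0) \<bullet> w) / t) \<longlongrightarrow> D w \<bullet> w) (at_right 0)"
    unfolding DERIV_def by (rule filterlim_mono[OF _ order_refl at_le]) simp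
  ultimately show ?thesis by (intro tendsto_lowerbound) auto
qed

text \<open>With \<open>p1 = p2\<close>, the full stability estimate is, after squaring, strong monotonicity of the
  inclusion with modulus \<open>\<kappa>\<close>; polyhedricity then supplies the directions to which
  \<open>derivative_bound_of_strong_monotonicity\<close> applies.\<close>

lemma positive_on_H_strong_of_fully_stable:
  fixes C :: "'a::real_inner set" and f :: "'a \<Rightarrow> 'p::metric_space \<Rightarrow> 'a"
  assumes C: "convex C" and poly: "polyhedric C"
    and A4: "assumption_A4 f xbar pbar"
    and fs: "fully_stable (solution_map f C) vbar pbar xbar"
    and z: "z \<in> H_strong C xbar (vbar - f xbar pbar)" "z \<noteq> 0"
  shows "0 < blinfun_apply (nabla_x f xbar pbar) z \<bullet> z"
proof -
  define F where "F x = f x pbar" for x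
  obtain V P U \<theta> \<kappa> l where V: "open V" "vbar \<in> V" and P: "pbar \<in> P" and U: "open U" "xbar \<in> U"
    and gph: "{(v, p, x). v \<in> V \<and> p \<in> P \<and> x = \<theta> v p} = {(v, p, x). x \<in> solution_map f C v p} \<inter> (V \<times> P \<times> U)"
    and \<kappa>: "0 < \<kappa>"
    and "\<forall>v1\<in>V. \<forall>v2\<in>V. \<forall>p1\<in>P. \<forall>p2\<in>P.
          norm ((v1 - v2) - (2 * \<kappa>) *\<^sub>R (\<theta> v1 p1 - \<theta> v2 p2)) \<le> norm (v1 - v2) + l * dist p1 p2"
    using fs unfolding fully_stable_def by (elim exE conjE) (rule that)
  then have ineq: "norm ((v1 - v2) - (2 * \<kappa>) *\<^sub>R (\<theta> v1 p1 - \<theta> v2 p2)) \<le> norm (v1 - v2) + l * dist p1 p2"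
    if "v1 \<in> V" "v2 \<in> V" "p1 \<in> P" "p2 \<in> P" for v1 v2 p1 p2
    using that by blast
  have mono: "\<kappa> * (norm (x1 - x2))\<^sup>2 \<le> ((n1 + F x1) - (n2 + F x2)) \<bullet> (x1 - x2)"
    if "n1 \<in> normal_cone C x1" "n2 \<in> normal_cone C x2" "x1 \<in> U" "x2 \<in> U"
      "n1 + F x1 \<in> V" "n2 + F x2 \<in> V" for x1 x2 n1 n2
  proof -
    define v where "v = (n1 + F x1) - (n2 + F x2)"
    have "\<theta> (n + F x) pbar = x" if "n \<in> normal_cone C x" "x \<in> U" "n + F x \<in> V" for n x
    proof -
      have "(n + F x, pbar, x) \<in> {(v, p, x). x \<in> solution_map f C v p} \<inter> (V \<times> P \<times> U)"
        using that P by (simp add: solution_map_iff F_def)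
      then show ?thesis unfolding gph[symmetric] by simp
    qed
    then have "norm (v - (2 * \<kappa>) *\<^sub>R (x1 - x2)) \<le> norm v"
      using ineq[of "n1 + F x1" "n2 + F x2" pbar pbar] that P by (simp add: v_def)
    then have "(norm (v - (2 * \<kappa>) *\<^sub>R (x1 - x2)))\<^sup>2 \<le> (norm v)\<^sup>2" by (simp add: power_mono)
    moreover have "(norm (v - (2 * \<kappa>) *\<^sub>R (x1 - x2)))\<^sup>2
        = (norm v)\<^sup>2 + 4 * \<kappa> * (\<kappa> * (norm (x1 - x2))\<^sup>2 - v \<bullet> (x1 - x2))"
      by (simp add: power2_norm_eq_inner inner_diff_left inner_diff_right inner_commute algebra_simps)
    ultimately have "4 * \<kappa> * (\<kappa> * (norm (x1 - x2))\<^sup>2 - v \<bullet> (x1 - x2)) \<le> 0" by linarith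
    then show ?thesis using \<kappa> by (simp add: mult_le_0_iff v_def)
  qed
  obtain U4 P4 where U4: "open U4" "xbar \<in> U4" and "open P4" and P4: "pbar \<in> P4"
    and diff: "\<forall>x\<in>U4. \<forall>p\<in>P4. (\<lambda>y. f y p) differentiable (at x)"
    using assumption_A4_differentiable[OF A4] .
  have cont: "isCont (\<lambda>(x, p). nabla_x f x p) (xbar, pbar)"
    using A4 by (simp add: assumption_A4_def)
  obtain xk nk zk where nk: "\<And>k. nk k \<in> normal_cone C (xk k)" and xk: "xk \<longlonglongrightarrow> xbar"
    and nk_lim: "nk \<longlonglongrightarrow> vbar - f xbar pbar" and zk: "\<And>k. zk k \<in> critical_cone C (xk k) (nk k)"
    and zk_lim: "(\<lambda>k. norm (zk k - z)) \<longlonglongrightarrow> 0"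
    using z(1) unfolding H_strong_def by blast
  have "\<exists>w. w \<in> radial_cone C (xk k) \<and> nk k \<bullet> w = 0 \<and> norm (w - zk k) < inverse (real (Suc k))" for k
  proof -
    have "zk k \<in> closure (radial_cone C (xk k) \<inter> {nk k}\<^sup>\<bottom>)"
      using poly zk[of k] nk[of k] normal_coneD(1)[OF nk[of k]] unfolding polyhedric_def polyhedric_at_def by blast
    then obtain w where "w \<in> radial_cone C (xk k) \<inter> {nk k}\<^sup>\<bottom>" "dist w (zk k) < inverse (real (Suc k))"
      unfolding closure_approachable by (meson inverse_positive_iff_positive of_nat_0_less_iff zero_less_Suc)
    then show ?thesis by (auto simp: orthogonal_comp_def orthogonal_def dist_norm)
  qed
  then obtain w where w: "\<And>k. w k \<in> radial_cone C (xk k)" "\<And>k. nk k \<bullet> w k = 0"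
    and w_near: "\<And>k. norm (w k - zk k) < inverse (real (Suc k))"
    by metis
  have "(\<lambda>k. w k - zk k) \<longlonglongrightarrow> 0"
    using w_near by (intro Lim_null_comparison[OF _ LIMSEQ_inverse_real_of_nat]) (simp add: less_imp_le del: of_nat_Suc)
  moreover have "(\<lambda>k. zk k - z) \<longlonglongrightarrow> 0" using zk_lim by (simp add: tendsto_norm_zero_iff)
  ultimately have "(\<lambda>k. (w k - zk k) + (zk k - z)) \<longlonglongrightarrow> 0 + 0" by (rule tendsto_add)
  then have w_lim: "w \<longlonglongrightarrow> z" by (simp add: LIM_zero_iff)
  have "isCont F xbar"
    using diff[rule_format, OF U4(2) P4] unfolding F_def by (rule differentiable_imp_continuous_within)
  then have "(\<lambda>k. nk k + F (xk k)) \<longlonglongrightarrow> (vbar - f xbar pbar) + F xbar"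
    by (intro tendsto_intros nk_lim isCont_tendsto_compose[OF _ xk])
  then have lim_v: "(\<lambda>k. nk k + F (xk k)) \<longlonglongrightarrow> vbar" by (simp add: F_def)
  have ev: "\<forall>\<^sub>F k in sequentially. \<kappa> * (norm (w k))\<^sup>2 \<le> blinfun_apply (nabla_x f (xk k) pbar) (w k) \<bullet> w k"
    using topological_tendstoD[OF lim_v V] topological_tendstoD[OF xk U] topological_tendstoD[OF xk U4]
  proof eventually_elim
    case (elim k)
    have "(F has_derivative blinfun_apply (nabla_x f (xk k) pbar)) (at (xk k))"
      unfolding F_def using diff[rule_format, OF elim(3) P4] by (rule nabla_x_has_derivative)
    then show ?case
      using elim U(1) V(1) mono
      by (intro derivative_bound_of_strong_monotonicity[where F = F and U = U and V = V, OF C nk w])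
  qed
  have "(\<lambda>k. (xk k, pbar)) \<longlonglongrightarrow> (xbar, pbar)" by (intro tendsto_intros xk)
  then have "(\<lambda>k. nabla_x f (xk k) pbar) \<longlonglongrightarrow> nabla_x f xbar pbar"
    using isCont_tendsto_compose[OF cont] by fastforce
  then have lim: "(\<lambda>k. blinfun_apply (nabla_x f (xk k) pbar) (w k) \<bullet> w k)
      \<longlonglongrightarrow> blinfun_apply (nabla_x f xbar pbar) z \<bullet> z"
    by (intro tendsto_intros w_lim)
  have "(\<lambda>k. \<kappa> * (norm (w k))\<^sup>2) \<longlonglongrightarrow> \<kappa> * (norm z)\<^sup>2" by (intro tendsto_intros w_lim)
  then have "\<kappa> * (norm z)\<^sup>2 \<le> blinfun_apply (nabla_x f xbar pbar) z \<bullet> z"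
    by (rule tendsto_le[OF _ lim _ ev, rotated]) simp
  moreover have "0 < \<kappa> * (norm z)\<^sup>2" using \<kappa> z(2) by simp
  ultimately show ?thesis by linarith
qed

section \<open>Second-order conditions for full stability\<close>

theorem theorem8p4:
  fixes C :: "'a::{real_inner, complete_space} set"
    and f :: "'a \<Rightarrow> 'p::metric_space \<Rightarrow> 'a"
    and xbar vbar :: 'a and pbar :: 'p
  defines "vhat \<equiv> vbar - f xbar pbar"
  assumes "closed C" and "convex C"
    and "xbar \<in> solution_map f C vbar pbar"
    and "assumption_A1 f xbar pbar"
    and "assumption_A4 f xbar pbar"
  shows
    "(Legendre_form (\<lambda>w. blinfun_apply (nabla_x f xbar pbar) w \<bullet> w) \<longrightarrow>
        (\<forall>w\<in>H_weak C xbar vhat. w \<noteq> 0 \<longrightarrow> blinfun_apply (nabla_x f xbar pbar) w \<bullet> w > 0) \<longrightarrow>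
        fully_stable (solution_map f C) vbar pbar xbar) \<and>
     (polyhedric C \<longrightarrow>
        fully_stable (solution_map f C) vbar pbar xbar \<longrightarrow>
        (\<forall>w\<in>H_strong C xbar vhat. w \<noteq> 0 \<longrightarrow> blinfun_apply (nabla_x f xbar pbar) w \<bullet> w > 0))"
proof (intro conjI impI ballI)
  assume Leg: "Legendre_form (\<lambda>w. blinfun_apply (nabla_x f xbar pbar) w \<bullet> w)"
    and H: "\<forall>w\<in>H_weak C xbar vhat. w \<noteq> 0 \<longrightarrow> 0 < blinfun_apply (nabla_x f xbar pbar) w \<bullet> w"
  obtain \<kappa> where \<kappa>: "0 < \<kappa>"
    and pos: "positive_on_critical_cones C (nabla_x f xbar pbar) \<kappa> \<kappa> xbar vhat"
    using uniformly_positive_on_critical_cones[OF Leg H] by blast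
  have lsc: "weakly_lsc (\<lambda>w. blinfun_apply (nabla_x f xbar pbar) w \<bullet> w)"
    using Leg by (simp add: Legendre_form_def)
  have "vhat \<in> normal_cone C xbar" using assms(4) by (simp add: solution_map_iff vhat_def)
  from strong_solvability_of_positive[OF assms(2,3) lsc \<kappa> \<kappa> this pos]
  obtain s where "strong_solvability C (blinfun_apply (nabla_x f xbar pbar)) \<kappa> s xbar
      (vhat + blinfun_apply (nabla_x f xbar pbar) xbar)"
    by blast
  then show "fully_stable (solution_map f C) vbar pbar xbar"
    unfolding vhat_def by (rule fully_stable_of_strong_solvability[OF assms(5,6) \<kappa>])
next
  fix w assume "polyhedric C" "fully_stable (solution_map f C) vbar pbar xbar"
    "w \<in> H_strong C xbar vhat" "w \<noteq> 0"
  then show "0 < blinfun_apply (nabla_x f xbar pbar) w \<bullet> w"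
    unfolding vhat_def using positive_on_H_strong_of_fully_stable[OF assms(3) _ assms(6)] by blast
qed

end
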